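(* Let $\kappa\in\{-1,0,1\}$, let $f:\mathbb{R}\to\mathbb{R}$ be smooth, and let $\varphi:\Sigma\to\mathbb{R}\times_f\mathbb{M}^2(\kappa)$ be an isometric immersion of a complete orientable surface with mean curvature function $H$ (with respect to a unit normal $N$). Let $z$ be a (local) conformal parameter for the first fundamental form, so that $$I=\lambda|dz|^2,\qquad II=p\,dz^2+\lambda H|dz|^2+\overline p\,d\overline z^2 .$$ Let $h$ be the height function and $\nu$ the angle function. Then, with $f,f',f''$ evaluated at $h$, the following equations hold: $$p_{\overline z}=\frac{\lambda}{2}H_z+\frac{\lambda}{2}(f''+\kappa e^{-2f})\nu h_z,$$ $$\|\nabla h\|^2=\frac{4}{\lambda}|h_z|^2,$$ $$\nu_z=-Hh_z-\frac{2p}{\lambda}h_{\overline z}-f'\nu h_z,$$ $$h_{z\overline z}=\nu\frac{\lambda H}{2}+f'\Big[\frac{\lambda}{2}-|h_z|^2\Big],$$ $$\nu_{z\overline z}=-(H_{\overline z}h_z+H_zh_{\overline z})-\frac{\lambda\nu}{4}\Big[(f''+\kappa e^{-2f})(1-\nu^2)+\frac{8|p|^2}{\lambda^2}+2H^2\Big]+f'\Big[\frac{2p}{\lambda}h_{\overline z}^2-H\Big(\frac{\lambda}{2}-|h_z|^2\Big)-(\nu_{\overline z}h_z+\nu h_{z\overline z})\Big]-f''\nu|h_z|^2.$$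
   Context: $\mathbb{M}^2(\kappa)$ is the complete simply connected surface of constant Gaussian curvature $\kappa$ with metric $d\sigma_\kappa^2$, and $\mathbb{R}\times_f\mathbb{M}^2(\kappa)$ is $\mathbb{R}\times\mathbb{M}^2(\kappa)$ with metric $dt^2+e^{2f(t)}d\sigma_\kappa^2$, Levi-Civita connection $\overline\nabla$. The shape operator $S$ of $\Sigma$ is given by $\overline\nabla_XN=-SX$; $I$ is the induced metric, $II(X,Y)=I(SX,Y)$, $H=\tfrac12\operatorname{tr}S$. The height function is $h=\pi_1\circ\varphi$, with $\pi_1(t,q)=t$, and $\nabla h$ is its gradient on $\Sigma$. The unit field $\xi=\partial_t$ is decomposed along $\Sigma$ as $\xi=T+\nu N$ with $T$ tangent; $\nu=\langle\xi,N\rangle$ is the angle function and $T=\nabla h$. For $z=x+iy$ set $\partial_z=\frac12(\partial_x-i\partial_y)$, $\partial_{\overline z}=\frac12(\partial_x+i\partial_y)$; tensors are extended complex-bilinearly, so $I(\partial_z,\partial_z)=0$, $I(\partial_z,\partial_{\overline z})=\lambda/2$, $p=II(\partial_z,\partial_z)$ (the coefficient of the Hopf differential $p\,dz^2$), $II(\partial_z,\partial_{\overline z})=\lambda H/2$. Subscripts $z,\overline z$ on functions denote derivatives. *)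

theory Defs
  imports "HOL-Analysis.Analysis"
begin

primrec Ck_on :: "nat \<Rightarrow> 'a::real_normed_vector set \<Rightarrow> ('a \<Rightarrow> 'b::real_normed_vector) \<Rightarrow> bool" where
  "Ck_on 0 U F \<longleftrightarrow> continuous_on U F"
| "Ck_on (Suc k) U F \<longleftrightarrow> (\<forall>x\<in>U. F differentiable (at x)) \<and>
     (\<forall>v. Ck_on k U (\<lambda>x. frechet_derivative F (at x) v))"

text \<open>Only used for open sets \<open>U\<close> in finite-dimensional spaces.\<close>

definition smooth_on :: "'a::real_normed_vector set \<Rightarrow> ('a \<Rightarrow> 'b::real_normed_vector) \<Rightarrow> bool" where
  "smooth_on U F \<longleftrightarrow> (\<forall>k. Ck_on k U F)"

text \<open>
  Let \<open>M\<close> be a submanifold of a finite-dimensional vector space \<open>V\<close>, with tangent spaces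
  \<open>T q \<subseteq> V\<close> and an arbitrary Riemannian metric \<open>g\<close> (not necessarily the induced one).
  Any connection on \<open>M\<close> differs from the derivative \<open>D\<close> of \<open>V\<close> by a tensor, so it is written
  \<open>\<nabla>\<^sub>u Y = D Y u + G q u (Y q)\<close> with \<open>G q\<close> bilinear; only the values of \<open>G q\<close> on
  \<open>T q \<times> T q\<close> are relevant. The connection is the Levi-Civita connection when it is tangential,
  torsion-free and compatible with \<open>g\<close>. The derivatives below are taken in directions
  tangent to \<open>M\<close>, hence do not depend on how the vector fields are extended off \<open>M\<close>.
\<close>

definition covariant_deriv ::
  "('v \<Rightarrow> 'v \<Rightarrow> 'v \<Rightarrow> 'v::euclidean_space) \<Rightarrow> ('v \<Rightarrow> 'v) \<Rightarrow> 'v \<Rightarrow> 'v \<Rightarrow> 'v" where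
  "covariant_deriv G Y q u = frechet_derivative Y (at q) u + G q u (Y q)"

definition tangent_field_on ::
  "'v::euclidean_space set \<Rightarrow> ('v \<Rightarrow> 'v set) \<Rightarrow> 'v set \<Rightarrow> ('v \<Rightarrow> 'v) \<Rightarrow> bool" where
  "tangent_field_on M T U Y \<longleftrightarrow> open U \<and> smooth_on U Y \<and> (\<forall>q\<in>U \<inter> M. Y q \<in> T q)"

definition lie_bracket :: "('v::euclidean_space \<Rightarrow> 'v) \<Rightarrow> ('v \<Rightarrow> 'v) \<Rightarrow> 'v \<Rightarrow> 'v" where
  "lie_bracket X Y q = frechet_derivative Y (at q) (X q) - frechet_derivative X (at q) (Y q)"

definition levi_civita ::
  "'v::euclidean_space set \<Rightarrow> ('v \<Rightarrow> 'v set) \<Rightarrow> ('v \<Rightarrow> 'v \<Rightarrow> 'v \<Rightarrow> real)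
    \<Rightarrow> ('v \<Rightarrow> 'v \<Rightarrow> 'v \<Rightarrow> 'v) \<Rightarrow> bool" where
  "levi_civita M T g G \<longleftrightarrow> (\<forall>q\<in>M. bilinear (G q)) \<and>
     (\<forall>U X Y Z. tangent_field_on M T U X \<and> tangent_field_on M T U Y \<and> tangent_field_on M T U Z \<longrightarrow>
       (\<forall>q\<in>U \<inter> M.
          covariant_deriv G Y q (X q) \<in> T q \<and>
          covariant_deriv G Y q (X q) - covariant_deriv G X q (Y q) = lie_bracket X Y q \<and>
          frechet_derivative (\<lambda>x. g x (Y x) (Z x)) (at q) (X q) =
            g q (covariant_deriv G Y q (X q)) (Z q) + g q (Y q) (covariant_deriv G Z q (X q))))"

definition covariant_deriv_along ::
  "('v \<Rightarrow> 'v \<Rightarrow> 'v \<Rightarrow> 'v::euclidean_space) \<Rightarrow> ('u::euclidean_space \<Rightarrow> 'v) \<Rightarrow> ('u \<Rightarrow> 'v) \<Rightarrow> 'u \<Rightarrow> 'u \<Rightarrow> 'v" where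
  "covariant_deriv_along G F Y z u =
     frechet_derivative Y (at z) u + G (F z) (frechet_derivative F (at z) u) (Y z)"

text \<open>
  For \<open>\<kappa> \<in> {-1, 0, 1}\<close> the set below, with the restriction of the form
  \<open>\<kappa> ds\<^sup>2 + |dw|\<^sup>2\<close> to its tangent planes, is respectively the hyperboloid model of the
  hyperbolic plane in Minkowski space, the Euclidean plane \<open>{1} \<times> \<complex>\<close>, and the unit sphere.
\<close>

definition space_form :: "real \<Rightarrow> (real \<times> complex) set" where
  "space_form \<kappa> = {(s, w). s\<^sup>2 + \<kappa> * (norm w)\<^sup>2 = 1 \<and> (\<kappa> \<le> 0 \<longrightarrow> s > 0)}"

definition space_form_tangent :: "real \<Rightarrow> real \<times> complex \<Rightarrow> (real \<times> complex) set" where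
  "space_form_tangent \<kappa> q = {v. fst q * fst v + \<kappa> * (snd q \<bullet> snd v) = 0}"

definition space_form_metric :: "real \<Rightarrow> real \<times> complex \<Rightarrow> real \<times> complex \<Rightarrow> real" where
  "space_form_metric \<kappa> u v = \<kappa> * (fst u * fst v) + snd u \<bullet> snd v"

type_synonym ambient = "real \<times> real \<times> complex"

definition warped_space :: "real \<Rightarrow> ambient set" where
  "warped_space \<kappa> = UNIV \<times> space_form \<kappa>"

definition warped_tangent :: "real \<Rightarrow> ambient \<Rightarrow> ambient set" where
  "warped_tangent \<kappa> q = UNIV \<times> space_form_tangent \<kappa> (snd q)"

definition warped_metric :: "real \<Rightarrow> (real \<Rightarrow> real) \<Rightarrow> ambient \<Rightarrow> ambient \<Rightarrow> ambient \<Rightarrow> real" where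
  "warped_metric \<kappa> f q u v =
     fst u * fst v + exp (2 * f (fst q)) * space_form_metric \<kappa> (snd u) (snd v)"

definition vertical_field :: ambient where
  "vertical_field = (1, 0, 0)"

type_synonym 'a chart = "'a set \<times> ('a \<Rightarrow> complex)"

definition local_rep :: "'a chart \<Rightarrow> ('a \<Rightarrow> 'b) \<Rightarrow> complex \<Rightarrow> 'b" where
  "local_rep c F = F \<circ> inv_into (fst c) (snd c)"

definition is_chart :: "'a::topological_space chart \<Rightarrow> bool" where
  "is_chart c \<longleftrightarrow> (case c of (U, x) \<Rightarrow>
     open U \<and> open (x ` U) \<and> homeomorphism U (x ` U) x (inv_into U x))"

definition smooth_transition :: "'a chart \<Rightarrow> 'a chart \<Rightarrow> bool" where
  "smooth_transition c d \<longleftrightarrow> smooth_on (snd c ` (fst c \<inter> fst d)) (local_rep c (snd d))"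

text \<open>Surfaces are given by their maximal smooth atlas.\<close>

definition smooth_surface :: "'a::{t2_space, second_countable_topology} chart set \<Rightarrow> bool" where
  "smooth_surface A \<longleftrightarrow>
     (\<forall>c\<in>A. is_chart c) \<and> (\<Union>c\<in>A. fst c) = UNIV \<and>
     (\<forall>c\<in>A. \<forall>d\<in>A. smooth_transition c d) \<and>
     (\<forall>c. is_chart c \<and> (\<forall>d\<in>A. smooth_transition c d \<and> smooth_transition d c) \<longrightarrow> c \<in> A)"

text \<open>The Jacobian determinant of a real-linear map \<open>L\<close> of \<open>\<complex>\<close> is \<open>Im (cnj (L 1) * L \<i>)\<close>.\<close>

definition orientable_surface :: "'a chart set \<Rightarrow> bool" where
  "orientable_surface A \<longleftrightarrow> (\<exists>B\<subseteq>A. (\<Union>c\<in>B. fst c) = UNIV \<and>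
     (\<forall>c\<in>B. \<forall>d\<in>B. \<forall>z\<in>snd c ` (fst c \<inter> fst d).
        let L = frechet_derivative (local_rep c (snd d)) (at z) in Im (cnj (L 1) * L \<i>) > 0))"

definition smooth_map :: "'a chart set \<Rightarrow> ('a \<Rightarrow> 'b::real_normed_vector) \<Rightarrow> bool" where
  "smooth_map A F \<longleftrightarrow> (\<forall>c\<in>A. smooth_on (snd c ` fst c) (local_rep c F))"

definition immersion_into :: "'v::euclidean_space set \<Rightarrow> 'a chart set \<Rightarrow> ('a \<Rightarrow> 'v) \<Rightarrow> bool" where
  "immersion_into M A F \<longleftrightarrow> smooth_map A F \<and> range F \<subseteq> M \<and>
     (\<forall>c\<in>A. \<forall>z\<in>snd c ` fst c. inj (frechet_derivative (local_rep c F) (at z)))"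

definition unit_normal ::
  "('v::euclidean_space \<Rightarrow> 'v set) \<Rightarrow> ('v \<Rightarrow> 'v \<Rightarrow> 'v \<Rightarrow> real) \<Rightarrow> 'a chart set \<Rightarrow> ('a \<Rightarrow> 'v) \<Rightarrow> ('a \<Rightarrow> 'v) \<Rightarrow> bool" where
  "unit_normal T g A F N \<longleftrightarrow> smooth_map A N \<and>
     (\<forall>p. N p \<in> T (F p) \<and> g (F p) (N p) (N p) = 1) \<and>
     (\<forall>c\<in>A. \<forall>p\<in>fst c. \<forall>u.
        g (F p) (frechet_derivative (local_rep c F) (at (snd c p)) u) (N p) = 0)"

text \<open>
  Completeness of the metric induced by \<open>F\<close>, in terms of the distance given by the infimum of
  the lengths of piecewise continuously differentiable paths; the speed of \<open>\<gamma>\<close> in the induced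
  metric is the speed of \<open>F \<circ> \<gamma>\<close>. Points in different components are at distance \<open>\<infinity>\<close>.
\<close>

definition piecewise_C1_path :: "'a::topological_space chart set \<Rightarrow> (real \<Rightarrow> 'a) \<Rightarrow> bool" where
  "piecewise_C1_path A \<gamma> \<longleftrightarrow> path \<gamma> \<and>
     (\<exists>E. finite E \<and> (\<forall>c\<in>A. (snd c \<circ> \<gamma>) C1_differentiable_on ({0..1} \<inter> \<gamma> -` fst c - E)))"

definition induced_length ::
  "('v::euclidean_space \<Rightarrow> 'v \<Rightarrow> 'v \<Rightarrow> real) \<Rightarrow> ('a \<Rightarrow> 'v) \<Rightarrow> (real \<Rightarrow> 'a) \<Rightarrow> ennreal" where
  "induced_length g F \<gamma> = (\<integral>\<^sup>+t\<in>{0..1}.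
     (let v = vector_derivative (F \<circ> \<gamma>) (at t) in ennreal (sqrt (g (F (\<gamma> t)) v v))) \<partial>lborel)"

definition induced_dist ::
  "('v::euclidean_space \<Rightarrow> 'v \<Rightarrow> 'v \<Rightarrow> real) \<Rightarrow> 'a::topological_space chart set \<Rightarrow> ('a \<Rightarrow> 'v) \<Rightarrow> 'a \<Rightarrow> 'a \<Rightarrow> ennreal" where
  "induced_dist g A F p q =
     (INF \<gamma>\<in>{\<gamma>. piecewise_C1_path A \<gamma> \<and> pathstart \<gamma> = p \<and> pathfinish \<gamma> = q}. induced_length g F \<gamma>)"

definition complete_induced ::
  "('v::euclidean_space \<Rightarrow> 'v \<Rightarrow> 'v \<Rightarrow> real) \<Rightarrow> 'a::topological_space chart set \<Rightarrow> ('a \<Rightarrow> 'v) \<Rightarrow> bool" where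
  "complete_induced g A F \<longleftrightarrow>
     (\<forall>s :: nat \<Rightarrow> 'a.
        (\<forall>e>0. \<exists>m0. \<forall>m\<ge>m0. \<forall>n\<ge>m0. induced_dist g A F (s m) (s n) < e) \<longrightarrow>
        (\<exists>p. (\<lambda>n. induced_dist g A F (s n) p) \<longlonglongrightarrow> 0))"

text \<open>
  Here \<open>X\<close> and \<open>n\<close> are the immersion and the unit normal expressed in a local parameter
  \<open>z \<in> \<complex>\<close>; tangent vectors of the surface are identified with their components, elements of \<open>\<complex>\<close>,
  so that \<open>\<partial>\<^sub>x\<close> and \<open>\<partial>\<^sub>y\<close> are \<open>1\<close> and \<open>\<i>\<close>.
\<close>

definition first_form ::
  "('v::euclidean_space \<Rightarrow> 'v \<Rightarrow> 'v \<Rightarrow> real) \<Rightarrow> (complex \<Rightarrow> 'v) \<Rightarrow> complex \<Rightarrow> complex \<Rightarrow> complex \<Rightarrow> real" where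
  "first_form g X z u v =
     g (X z) (frechet_derivative X (at z) u) (frechet_derivative X (at z) v)"

definition shape_operator ::
  "('v \<Rightarrow> 'v \<Rightarrow> 'v \<Rightarrow> 'v::euclidean_space) \<Rightarrow> (complex \<Rightarrow> 'v) \<Rightarrow> (complex \<Rightarrow> 'v) \<Rightarrow> complex \<Rightarrow> complex \<Rightarrow> complex" where
  "shape_operator G X n z u =
     (THE w. covariant_deriv_along G X n z u = - frechet_derivative X (at z) w)"

definition second_form ::
  "('v::euclidean_space \<Rightarrow> 'v \<Rightarrow> 'v \<Rightarrow> real) \<Rightarrow> ('v \<Rightarrow> 'v \<Rightarrow> 'v \<Rightarrow> 'v)
    \<Rightarrow> (complex \<Rightarrow> 'v) \<Rightarrow> (complex \<Rightarrow> 'v) \<Rightarrow> complex \<Rightarrow> complex \<Rightarrow> complex \<Rightarrow> real" where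
  "second_form g G X n z u v = first_form g X z (shape_operator G X n z u) v"

definition mean_curvature ::
  "('v \<Rightarrow> 'v \<Rightarrow> 'v \<Rightarrow> 'v::euclidean_space) \<Rightarrow> (complex \<Rightarrow> 'v) \<Rightarrow> (complex \<Rightarrow> 'v) \<Rightarrow> complex \<Rightarrow> real" where
  "mean_curvature G X n z = (\<Sum>b\<in>Basis. shape_operator G X n z b \<bullet> b) / 2"

definition gradient ::
  "('v::euclidean_space \<Rightarrow> 'v \<Rightarrow> 'v \<Rightarrow> real) \<Rightarrow> (complex \<Rightarrow> 'v) \<Rightarrow> (complex \<Rightarrow> real) \<Rightarrow> complex \<Rightarrow> complex" where
  "gradient g X k z = (THE w. \<forall>u. first_form g X z w u = frechet_derivative k (at z) u)"

text \<open>
  Complexified tangent vectors \<open>a \<partial>\<^sub>x + b \<partial>\<^sub>y\<close> are represented by pairs \<open>(a, b)\<close> of complex numbers.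
\<close>

definition complex_bilinear_ext ::
  "(complex \<Rightarrow> complex \<Rightarrow> real) \<Rightarrow> complex \<times> complex \<Rightarrow> complex \<times> complex \<Rightarrow> complex" where
  "complex_bilinear_ext B u v =
     fst u * fst v * of_real (B 1 1) + fst u * snd v * of_real (B 1 \<i>) +
     snd u * fst v * of_real (B \<i> 1) + snd u * snd v * of_real (B \<i> \<i>)"

definition partial_z :: "complex \<times> complex" where
  "partial_z = (1 / 2, - \<i> / 2)"

definition hopf_coeff ::
  "('v::euclidean_space \<Rightarrow> 'v \<Rightarrow> 'v \<Rightarrow> real) \<Rightarrow> ('v \<Rightarrow> 'v \<Rightarrow> 'v \<Rightarrow> 'v)
    \<Rightarrow> (complex \<Rightarrow> 'v) \<Rightarrow> (complex \<Rightarrow> 'v) \<Rightarrow> complex \<Rightarrow> complex" where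
  "hopf_coeff g G X n z = complex_bilinear_ext (second_form g G X n z) partial_z partial_z"

definition d_z :: "(complex \<Rightarrow> complex) \<Rightarrow> complex \<Rightarrow> complex" where
  "d_z F z = (frechet_derivative F (at z) 1 - \<i> * frechet_derivative F (at z) \<i>) / 2"

definition d_zbar :: "(complex \<Rightarrow> complex) \<Rightarrow> complex \<Rightarrow> complex" where
  "d_zbar F z = (frechet_derivative F (at z) 1 + \<i> * frechet_derivative F (at z) \<i>) / 2"

end

theory Submission
  imports Defs
begin

text \<open>
  On tangent vectors, the Levi-Civita connection of the warped product is forced (torsion-free and
  metric, by the usual permutation argument) to be given by an explicit Christoffel tensor. Along the
  immersion this gives a covariant derivative \<open>\<nabla>\<^sub>u\<close> in real coordinate directions \<open>u \<in> \<complex>\<close>, compatible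
  with the metric and satisfying \<open>\<nabla>\<^sub>u \<partial>\<^sub>t = f' (e\<^sub>u - h\<^sub>u \<partial>\<^sub>t)\<close>, where \<open>e\<^sub>u\<close> is the derivative of the immersion.
  Differentiating \<open>h\<^sub>u = \<langle>\<partial>\<^sub>t, e\<^sub>u\<rangle>\<close> and \<open>\<nu> = \<langle>\<partial>\<^sub>t, N\<rangle>\<close>, and expanding in the orthogonal frame
  \<open>e\<^sub>1, e\<^sub>\<i>, N\<close>, gives the equations for \<open>h\<close> and \<open>\<nu>\<^sub>z\<close>; the curvature tensor gives the Codazzi equation,
  hence the one for \<open>p\<close>. The last equation is the conjugate derivative of the third one.
\<close>

section \<open>Directional derivatives of smooth maps\<close>

text \<open>The connection \<open>G\<close> is constrained only through tangent fields on open
  subsets of the linear ambient space, and only at points of the warped product. It is therefore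
  tested on polynomial fields extending given tangent vectors, built from a transversal field that
  serves all three values of \<kappa> at once. Once \<open>G\<close> is explicit on tangent vectors,
  what remains is real calculus on an open set of the parameter plane; curvature is a commutator of
  explicit derivatives, which calls for symmetry of second derivatives. The obstacle in the last
  equation is the term \<open>2 p / \<lambda>\<close> times the conjugate derivative of
  \<open>h\<close>. Differentiating it requires the pure second derivative of \<open>h\<close> in
  the conjugate variable, which is not among the stated equations, and it brings in derivatives of
  \<lambda>. Those from the quotient and those from the Christoffel symbols of the conformal metric
  cancel.\<close>

definition dird :: "'a::real_normed_vector \<Rightarrow> ('a \<Rightarrow> 'b::real_normed_vector) \<Rightarrow> 'a \<Rightarrow> 'b" where
  "dird u F x = frechet_derivative F (at x) u"

lemma dird_eq:
  assumes "(F has_derivative F') (at x)"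
  shows "dird u F x = F' u"
  using frechet_derivative_at[OF assms] by (simp add: dird_def)

lemma has_derivative_dird:
  assumes "F differentiable (at x)"
  shows "(F has_derivative (\<lambda>u. dird u F x)) (at x)"
  using assms by (simp add: dird_def frechet_derivative_works)

lemma smooth_on_differentiable: "smooth_on U F \<Longrightarrow> x \<in> U \<Longrightarrow> F differentiable (at x)"
  unfolding smooth_on_def by (metis Ck_on.simps(2))

lemma smooth_on_dird:
  assumes "smooth_on U F"
  shows "smooth_on U (dird u F)"
  using assms unfolding smooth_on_def dird_def by (metis Ck_on.simps(2))

lemma smooth_on_continuous: "smooth_on U F \<Longrightarrow> continuous_on U F"
  unfolding smooth_on_def by (metis Ck_on.simps(1))

lemma smooth_on_has_derivative:
  "smooth_on U F \<Longrightarrow> x \<in> U \<Longrightarrow> (F has_derivative (\<lambda>u. dird u F x)) (at x)"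
  by (intro has_derivative_dird smooth_on_differentiable)

lemma smooth_on_const: "smooth_on UNIV (\<lambda>x. c)"
proof -
  have "Ck_on k UNIV (\<lambda>x. d)" for k :: nat and d :: 'b
    by (induction k arbitrary: d) (auto simp: frechet_derivative_const)
  then show ?thesis by (auto simp: smooth_on_def)
qed

text \<open>Polynomial maps are handled by degree: each derivative is an explicit map of lower
  degree whose smoothness is already known, from constants through affine maps to quadratic
  ones.\<close>

lemma smooth_onI:
  assumes "\<And>x. (F has_derivative F' x) (at x)" and "\<And>v. smooth_on UNIV (\<lambda>x. F' x v)"
  shows "smooth_on UNIV F"
  unfolding smooth_on_def
proof
  fix k
  show "Ck_on k UNIV F"
  proof (cases k)
    case 0
    have "continuous_on UNIV F"
      using assms(1) has_derivative_continuous continuous_at_imp_continuous_on by blast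
    then show ?thesis using 0 by simp
  next
    case (Suc j)
    have "frechet_derivative F (at x) = F' x" for x
      by (rule frechet_derivative_at[OF assms(1), symmetric])
    moreover have "\<forall>x\<in>UNIV. F differentiable (at x)"
      using assms(1) differentiable_def by blast
    moreover have "\<forall>v. Ck_on j UNIV (\<lambda>x. F' x v)"
      using assms(2) smooth_on_def by blast
    ultimately show ?thesis by (simp add: Suc)
  qed
qed

lemma smooth_on_affine:
  assumes "bounded_linear L"
  shows "smooth_on UNIV (\<lambda>x. L x + c)"
proof (rule smooth_onI)
  show "((\<lambda>x. L x + c) has_derivative L) (at x)" for x
    using has_derivative_add[OF bounded_linear_imp_has_derivative[OF assms] has_derivative_const] by simp
qed (rule smooth_on_const)

section \<open>Symmetry of second derivatives\<close>

lemma mixed_difference: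
  fixes F :: "'a::real_normed_vector \<Rightarrow> real"
  assumes t: "t > 0"
    and in_U: "\<And>s r. 0 \<le> s \<Longrightarrow> s \<le> t \<Longrightarrow> 0 \<le> r \<Longrightarrow> r \<le> t \<Longrightarrow> z + s *\<^sub>R u + r *\<^sub>R v \<in> U"
    and F: "smooth_on U F"
  obtains s r where "0 < s" "s < t" "0 < r" "r < t"
    "F (z + t *\<^sub>R u + t *\<^sub>R v) - F (z + t *\<^sub>R u) - F (z + t *\<^sub>R v) + F z =
      t * t * dird v (dird u F) (z + s *\<^sub>R u + r *\<^sub>R v)"
proof -
  note dF = smooth_on_has_derivative[OF F]
  note dFu = smooth_on_has_derivative[OF smooth_on_dird[OF F, of u]]
  have aux: "((\<lambda>s. F (z + s *\<^sub>R u + r *\<^sub>R v)) has_derivative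
      (\<lambda>h. h * dird u F (z + s *\<^sub>R u + r *\<^sub>R v))) (at s)"
    if "0 \<le> s" "s \<le> t" "0 \<le> r" "r \<le> t" for s r
  proof -
    have D: "(F has_derivative (\<lambda>w. dird w F (z + s *\<^sub>R u + r *\<^sub>R v))) (at (z + s *\<^sub>R u + r *\<^sub>R v))"
      using dF[OF in_U[OF that]] .
    have "((\<lambda>s. F (z + s *\<^sub>R u + r *\<^sub>R v)) has_derivative
        (\<lambda>h. dird (h *\<^sub>R u) F (z + s *\<^sub>R u + r *\<^sub>R v))) (at s)"
      by (rule has_derivative_compose[of "\<lambda>s. z + s *\<^sub>R u + r *\<^sub>R v", OF _ D]) (auto intro!: derivative_eq_intros)
    then show ?thesis
      using linear_scale[OF has_derivative_linear[OF D]] by simp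
  qed
  have aux2: "((\<lambda>r. dird u F (z + s *\<^sub>R u + r *\<^sub>R v)) has_derivative
      (\<lambda>h. h * dird v (dird u F) (z + s *\<^sub>R u + r *\<^sub>R v))) (at r)"
    if "0 \<le> s" "s \<le> t" "0 \<le> r" "r \<le> t" for s r
  proof -
    have D: "(dird u F has_derivative (\<lambda>w. dird w (dird u F) (z + s *\<^sub>R u + r *\<^sub>R v))) (at (z + s *\<^sub>R u + r *\<^sub>R v))"
      by (rule dFu[OF in_U[OF that]])
    have "((\<lambda>r. dird u F (z + s *\<^sub>R u + r *\<^sub>R v)) has_derivative
        (\<lambda>h. dird (h *\<^sub>R v) (dird u F) (z + s *\<^sub>R u + r *\<^sub>R v))) (at r)"
      by (rule has_derivative_compose[of "\<lambda>r. z + s *\<^sub>R u + r *\<^sub>R v", OF _ D]) (auto intro!: derivative_eq_intros)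
    then show ?thesis
      using linear_scale[OF has_derivative_linear[OF D]] by simp
  qed
  define C where "C s r = F (z + s *\<^sub>R u + r *\<^sub>R v)" for s r
  define A where "A s r = dird u F (z + s *\<^sub>R u + r *\<^sub>R v)" for s r
  define B where "B s r = dird v (dird u F) (z + s *\<^sub>R u + r *\<^sub>R v)" for s r
  have dC: "((\<lambda>s. C s r) has_derivative (\<lambda>h. h * A s r)) (at s)"
    if "0 \<le> s" "s \<le> t" "0 \<le> r" "r \<le> t" for s r
    using aux[OF that] by (simp only: C_def A_def)
  have dA: "(A s has_derivative (\<lambda>h. h * B s r)) (at r)"
    if "0 \<le> s" "s \<le> t" "0 \<le> r" "r \<le> t" for s r
    using aux2[OF that] unfolding A_def[abs_def] B_def .
  have dCC: "((\<lambda>s. C s t - C s 0) has_derivative (\<lambda>h. h * A s t - h * A s 0)) (at s)"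
    if "0 \<le> s" "s \<le> t" for s
    using that t by (intro has_derivative_diff dC) auto
  \<comment> \<open>The mean value theorem is applied to the difference of \<open>F\<close> along
    two opposite sides as a function of \<open>s\<close>, and then, for the \<open>s\<close> found,
    to \<open>A s\<close> in the other direction.\<close>
  have "\<exists>s\<in>{0<..<t}. (C t t - C t 0) - (C 0 t - C 0 0) = (t - 0) * A s t - (t - 0) * A s 0"
    by (rule mvt_simple[OF t, of "\<lambda>s. C s t - C s 0" "\<lambda>s h. h * A s t - h * A s 0"])
       (rule has_derivative_at_withinI, rule dCC)
  then obtain s where s: "0 < s" "s < t" and
    1: "(C t t - C t 0) - (C 0 t - C 0 0) = t * (A s t - A s 0)"
    by (auto simp: right_diff_distrib)
  have "\<exists>r\<in>{0<..<t}. A s t - A s 0 = (t - 0) * B s r"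
    by (rule mvt_simple[OF t, of "A s" "\<lambda>r h. h * B s r"], rule has_derivative_at_withinI, rule dA) (use s in auto)
  then obtain r where r: "0 < r" "r < t" and 2: "A s t - A s 0 = t * B s r" by auto
  have "C t t - C t 0 - C 0 t + C 0 0 = t * t * B s r"
    using 1[unfolded 2] by simp
  with s r show ?thesis by (intro that[of s r]) (simp_all add: C_def B_def)
qed

text \<open>The second difference over a parallelogram is symmetric in \<open>u\<close> and
  \<open>v\<close>, so the two mixed derivatives take a common value at two points near
  \<open>z\<close>; continuity carries the equality to \<open>z\<close>.\<close>

lemma dird_dird_commute_real:
  fixes F :: "'a::real_normed_vector \<Rightarrow> real"
  assumes U: "open U" and F: "smooth_on U F" and z: "z \<in> U"
  shows "dird v (dird u F) z = dird u (dird v F) z"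
proof (rule ccontr)
  assume ne: "dird v (dird u F) z \<noteq> dird u (dird v F) z"
  define \<epsilon> where "\<epsilon> = \<bar>dird v (dird u F) z - dird u (dird v F) z\<bar> / 2"
  have e: "\<epsilon> > 0" using ne by (simp add: \<epsilon>_def)
  have c: "isCont (dird v (dird u F)) z" for u v
    using smooth_on_continuous[OF smooth_on_dird[OF smooth_on_dird[OF F]]] U z continuous_on_eq_continuous_at by blast
  obtain d1 where d1: "d1 > 0" "\<And>x. dist x z < d1 \<Longrightarrow> \<bar>dird v (dird u F) x - dird v (dird u F) z\<bar> < \<epsilon>"
    using c[of v u, unfolded continuous_at_eps_delta, THEN spec, THEN mp, OF e] unfolding dist_real_def by blast
  obtain d2 where d2: "d2 > 0" "\<And>x. dist x z < d2 \<Longrightarrow> \<bar>dird u (dird v F) x - dird u (dird v F) z\<bar> < \<epsilon>"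
    using c[of u v, unfolded continuous_at_eps_delta, THEN spec, THEN mp, OF e] unfolding dist_real_def by blast
  obtain d3 where d3: "d3 > 0" "\<And>x. dist x z < d3 \<Longrightarrow> x \<in> U"
    using U z unfolding open_dist by blast
  define d where "d = Min {d1, d2, d3}"
  \<comment> \<open>Small enough for the parallelogram with sides \<open>t *\<^sub>R u\<close> and
    \<open>t *\<^sub>R v\<close> to stay within distance \<open>d\<close> of \<open>z\<close>; the
    summand 1 covers \<open>u = v = 0\<close>.\<close>
  define t where "t = d / (2 * (norm u + norm v + 1))"
  have d: "d > 0" "d \<le> d1" "d \<le> d2" "d \<le> d3" using d1 d2 d3 by (auto simp: d_def)
  have np: "2 * (norm u + norm v + 1) > 0" by (simp add: add_nonneg_pos)
  have t: "t > 0" using d np by (simp add: t_def)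
  have near: "dist (z + s *\<^sub>R u + r *\<^sub>R v) z < d"
    if "0 \<le> s" "s \<le> t" "0 \<le> r" "r \<le> t" for s r
  proof -
    have "dist (z + s *\<^sub>R u + r *\<^sub>R v) z = norm (s *\<^sub>R u + r *\<^sub>R v)"
      by (simp add: dist_norm add.assoc)
    also have "\<dots> \<le> s * norm u + r * norm v"
      using that norm_triangle_ineq[of "s *\<^sub>R u" "r *\<^sub>R v"] by simp
    also have "\<dots> \<le> t * norm u + t * norm v"
      using that by (intro add_mono mult_right_mono) auto
    also have "\<dots> < t * (2 * (norm u + norm v + 1))"
      using t by (simp add: algebra_simps add_nonneg_pos)
    also have "\<dots> = d" unfolding t_def using np by (simp del: distrib_left_numeral)
    finally show ?thesis .
  qed
  have near': "dist (z + r *\<^sub>R v + s *\<^sub>R u) z < d"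
    if "0 \<le> s" "s \<le> t" "0 \<le> r" "r \<le> t" for s r
    using near[OF that] by (simp add: algebra_simps)
  have "\<And>s r. 0 \<le> s \<Longrightarrow> s \<le> t \<Longrightarrow> 0 \<le> r \<Longrightarrow> r \<le> t \<Longrightarrow> z + s *\<^sub>R u + r *\<^sub>R v \<in> U"
    by (rule d3(2), rule less_le_trans[OF near d(4)])
  then obtain s r where sr: "0 < s" "s < t" "0 < r" "r < t"
    "F (z + t *\<^sub>R u + t *\<^sub>R v) - F (z + t *\<^sub>R u) - F (z + t *\<^sub>R v) + F z =
      t * t * dird v (dird u F) (z + s *\<^sub>R u + r *\<^sub>R v)"
    using mixed_difference[OF t _ F] by blast
  have "\<And>s r. 0 \<le> s \<Longrightarrow> s \<le> t \<Longrightarrow> 0 \<le> r \<Longrightarrow> r \<le> t \<Longrightarrow> z + s *\<^sub>R v + r *\<^sub>R u \<in> U"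
    by (rule d3(2), rule less_le_trans[OF near' d(4)])
  then obtain s' r' where sr': "0 < s'" "s' < t" "0 < r'" "r' < t"
    "F (z + t *\<^sub>R v + t *\<^sub>R u) - F (z + t *\<^sub>R v) - F (z + t *\<^sub>R u) + F z =
      t * t * dird u (dird v F) (z + s' *\<^sub>R v + r' *\<^sub>R u)"
    using mixed_difference[OF t _ F] by blast
  have "z + t *\<^sub>R v + t *\<^sub>R u = z + t *\<^sub>R u + t *\<^sub>R v" by simp
  from sr(5) sr'(5)[unfolded this] have "t * t * dird v (dird u F) (z + s *\<^sub>R u + r *\<^sub>R v) =
      t * t * dird u (dird v F) (z + s' *\<^sub>R v + r' *\<^sub>R u)" by linarith
  then have "dird v (dird u F) (z + s *\<^sub>R u + r *\<^sub>R v) = dird u (dird v F) (z + s' *\<^sub>R v + r' *\<^sub>R u)"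
    using t by simp
  moreover have "\<bar>dird v (dird u F) (z + s *\<^sub>R u + r *\<^sub>R v) - dird v (dird u F) z\<bar> < \<epsilon>"
    by (rule d1(2), rule less_le_trans[OF near d(2)]) (use sr in auto)
  moreover have "\<bar>dird u (dird v F) (z + s' *\<^sub>R v + r' *\<^sub>R u) - dird u (dird v F) z\<bar> < \<epsilon>"
    by (rule d2(2), rule less_le_trans[OF near' d(3)]) (use sr' in auto)
  ultimately have "\<bar>dird v (dird u F) z - dird u (dird v F) z\<bar> < \<epsilon> + \<epsilon>"
    by (smt (verit, best))
  then show False by (simp add: \<epsilon>_def)
qed

lemma smooth_on_inner:
  fixes F :: "'a::real_normed_vector \<Rightarrow> 'b::real_inner"
  assumes U: "open U" and F: "smooth_on U F"
  shows "smooth_on U (\<lambda>x. F x \<bullet> b)"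
proof -
  \<comment> \<open>Generalised to every \<open>H\<close> that agrees with the component on
    \<open>U\<close>: the derivative of the component is a component of the derivative only at
    points of \<open>U\<close>, so the induction hypothesis must tolerate other values
    outside.\<close>
  have *: "Ck_on k U F \<Longrightarrow> (\<And>x. x \<in> U \<Longrightarrow> H x = F x \<bullet> b) \<Longrightarrow> Ck_on k U H" for k F and H :: "'a \<Rightarrow> real"
  proof (induction k arbitrary: F H)
    case 0
    then have "continuous_on U (\<lambda>x. F x \<bullet> b)" by (auto intro!: continuous_intros)
    then show ?case using 0 continuous_on_cong by fastforce
  next
    case (Suc k)
    have D: "(H has_derivative (\<lambda>v. frechet_derivative F (at x) v \<bullet> b)) (at x)" if "x \<in> U" for x
    proof -
      have "(F has_derivative frechet_derivative F (at x)) (at x)"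
        using Suc.prems(1) that by (simp add: frechet_derivative_works)
      then have "((\<lambda>x. F x \<bullet> b) has_derivative (\<lambda>v. frechet_derivative F (at x) v \<bullet> b)) (at x)"
        by (rule has_derivative_inner_left)
      then show ?thesis
        by (rule has_derivative_transform_within_open[OF _ U that]) (simp add: Suc.prems(2))
    qed
    have "Ck_on k U (\<lambda>x. frechet_derivative H (at x) v)" for v
    proof (rule Suc.IH)
      show "Ck_on k U (\<lambda>x. frechet_derivative F (at x) v)" using Suc.prems(1) by simp
      show "frechet_derivative H (at x) v = frechet_derivative F (at x) v \<bullet> b" if "x \<in> U" for x
        using fun_cong[OF frechet_derivative_at[OF D[OF that]], of v] by simp
    qed
    with D show ?case by (auto simp: differentiable_def)
  qed
  show ?thesis
    unfolding smooth_on_def using F by (intro allI *[of _ F]) (simp_all add: smooth_on_def)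
qed

lemma dird_inner:
  fixes F :: "'a::real_normed_vector \<Rightarrow> 'b::real_inner"
  assumes "F differentiable (at x)"
  shows "dird u (\<lambda>x. F x \<bullet> b) x = dird u F x \<bullet> b"
  by (rule dird_eq) (intro has_derivative_inner_left has_derivative_dird assms)

lemma dird_cong:
  assumes "open U" "x \<in> U" "\<And>y. y \<in> U \<Longrightarrow> F y = H y"
  shows "dird u F x = dird u H x"
proof -
  have "(F has_derivative D) (at x) \<longleftrightarrow> (H has_derivative D) (at x)" for D
    using has_derivative_transform_within_open[OF _ assms(1,2)] assms(3) by metis
  then show ?thesis by (simp add: dird_def frechet_derivative_def)
qed

lemma dird_dird_commute:
  fixes F :: "'a::real_normed_vector \<Rightarrow> 'b::euclidean_space"
  assumes U: "open U" and F: "smooth_on U F" and z: "z \<in> U"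
  shows "dird v (dird u F) z = dird u (dird v F) z"
proof (rule euclidean_eqI)
  fix b :: 'b
  have *: "dird v (dird u F) z \<bullet> b = dird v (dird u (\<lambda>x. F x \<bullet> b)) z" for u v
  proof -
    have "dird v (dird u F) z \<bullet> b = dird v (\<lambda>x. dird u F x \<bullet> b) z"
      by (simp add: dird_inner smooth_on_differentiable[OF smooth_on_dird[OF F] z])
    also have "\<dots> = dird v (dird u (\<lambda>x. F x \<bullet> b)) z"
      by (rule dird_cong[OF U z]) (simp add: dird_inner smooth_on_differentiable[OF F])
    finally show ?thesis .
  qed
  show "dird v (dird u F) z \<bullet> b = dird u (dird v F) z \<bullet> b"
    unfolding * by (rule dird_dird_commute_real[OF U smooth_on_inner[OF U F] z])
qed

section \<open>The Levi-Civita connection of the warped product\<close>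

lemma smooth_on_quadratic:
  assumes "bounded_bilinear B"
  shows "smooth_on UNIV (\<lambda>x. B x x + c)"
proof (rule smooth_onI)
  interpret bounded_bilinear B by fact
  show "((\<lambda>x. B x x + c) has_derivative (\<lambda>h. B x h + B h x)) (at x)" for x
    using has_derivative_add[OF FDERIV[OF has_derivative_ident has_derivative_ident] has_derivative_const]
    by simp
  show "smooth_on UNIV (\<lambda>x. B x v + B v x)" for v
    using smooth_on_affine[OF bounded_linear_add[OF bounded_linear_left[of v] bounded_linear_right[of v]], of 0]
    by simp
qed

section \<open>The fibre metric, the connection tensor and polynomial tangent fields\<close>

lemma bounded_bilinear_space_form_metric: "bounded_bilinear (space_form_metric \<kappa>)"
  unfolding bilinear_conv_bounded_bilinear[symmetric] bilinear_def
  by (auto intro!: linearI simp: space_form_metric_def algebra_simps)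

interpretation space_form_metric: bounded_bilinear "space_form_metric \<kappa>" for \<kappa>
  by (rule bounded_bilinear_space_form_metric)

lemma space_form_metric_commute: "space_form_metric \<kappa> u v = space_form_metric \<kappa> v u"
  by (simp add: space_form_metric_def inner_commute mult.commute)

text \<open>A normal field of the space form that, unlike \<open>q\<close> itself, also works for \<open>\<kappa> = 0\<close>.\<close>

definition fiber_normal :: "real \<Rightarrow> real \<times> complex \<Rightarrow> real \<times> complex" where
  "fiber_normal \<kappa> q = (fst q, \<kappa>\<^sup>2 *\<^sub>R snd q)"

text \<open>The \<open>deriv f\<close> terms come from the warping. The \<open>fiber_normal\<close>
  term removes the normal part of the flat derivative and so turns it into the connection of the
  fibre; it is the second fundamental form of the quadric.\<close>

definition warped_christoffel ::
  "real \<Rightarrow> (real \<Rightarrow> real) \<Rightarrow> ambient \<Rightarrow> ambient \<Rightarrow> ambient \<Rightarrow> ambient" where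
  "warped_christoffel \<kappa> f q u v =
     (- (deriv f (fst q) * exp (2 * f (fst q)) * space_form_metric \<kappa> (snd u) (snd v)),
      (\<kappa> * space_form_metric \<kappa> (snd u) (snd v)) *\<^sub>R fiber_normal \<kappa> (snd q) +
      deriv f (fst q) *\<^sub>R (fst u *\<^sub>R snd v + fst v *\<^sub>R snd u))"

text \<open>The coefficient subtracted is the functional whose kernel is the tangent space at
  \<open>x\<close>, so the transversal part of the constant vector is projected away. The field is
  quadratic in \<open>x\<close>, hence smooth on the whole linear space.\<close>

definition tangent_extension :: "real \<Rightarrow> ambient \<Rightarrow> ambient \<Rightarrow> ambient" where
  "tangent_extension \<kappa> v x =
     (fst v, snd v - (fst (snd x) * fst (snd v) + \<kappa> * (snd (snd x) \<bullet> snd (snd v))) *\<^sub>R fiber_normal \<kappa> (snd x))"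

text \<open>Polarisation of the quadratic part of \<open>tangent_extension\<close>, so that the
  rules for bounded bilinear maps give its smoothness and its derivative.\<close>

definition tangent_extension_part :: "real \<Rightarrow> ambient \<Rightarrow> ambient \<Rightarrow> ambient \<Rightarrow> ambient" where
  "tangent_extension_part \<kappa> v x y =
     (0, - ((fst (snd x) * fst (snd v) + \<kappa> * (snd (snd x) \<bullet> snd (snd v))) *\<^sub>R fiber_normal \<kappa> (snd y)))"

lemma tangent_extension_eq: "tangent_extension \<kappa> v = (\<lambda>x. tangent_extension_part \<kappa> v x x + v)"
  by (auto simp: fun_eq_iff tangent_extension_def tangent_extension_part_def prod_eq_iff)

lemma bounded_bilinear_tangent_extension_part: "bounded_bilinear (tangent_extension_part \<kappa> v)"
  unfolding bilinear_conv_bounded_bilinear[symmetric] bilinear_def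
  by (auto intro!: linearI simp: tangent_extension_part_def fiber_normal_def algebra_simps)

lemma smooth_tangent_extension: "smooth_on UNIV (tangent_extension \<kappa> v)"
  unfolding tangent_extension_eq
  by (rule smooth_on_quadratic[OF bounded_bilinear_tangent_extension_part])

lemma has_derivative_tangent_extension:
  "(tangent_extension \<kappa> v has_derivative
     (\<lambda>u. tangent_extension_part \<kappa> v q u + tangent_extension_part \<kappa> v u q)) (at q)"
proof -
  have "((\<lambda>x. tangent_extension_part \<kappa> v x x) has_derivative
     (\<lambda>u. tangent_extension_part \<kappa> v q u + tangent_extension_part \<kappa> v u q)) (at q)"
    by (rule bounded_bilinear.FDERIV[OF bounded_bilinear_tangent_extension_part
        has_derivative_ident has_derivative_ident])
  from has_derivative_add[OF this has_derivative_const[of v]] show ?thesis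
    by (simp add: tangent_extension_eq)
qed

lemma kappa_cube: "\<kappa> \<in> {-1, 0, 1 :: real} \<Longrightarrow> \<kappa> * \<kappa>\<^sup>2 = \<kappa>"
  by auto

lemma kappa_fiber_normal: "\<kappa> \<in> {-1, 0, 1} \<Longrightarrow> \<kappa> *\<^sub>R fiber_normal \<kappa> q = \<kappa> *\<^sub>R q"
  using kappa_cube by (simp add: fiber_normal_def prod_eq_iff)

lemma space_form_metric_fiber_normal:
  "space_form_metric \<kappa> (fiber_normal \<kappa> q) v = \<kappa> * (fst q * fst v + \<kappa> * (snd q \<bullet> snd v))"
  by (simp add: space_form_metric_def fiber_normal_def algebra_simps power2_eq_square)

text \<open>The hyperbolic case is the substantial one: tangency, Cauchy-Schwarz and
  \<open>(norm w)\<^sup>2 = s\<^sup>2 - 1\<close> show that tangent planes are spacelike. For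
  \<kappa> = 0 tangency forces \<open>b = 0\<close>.\<close>

lemma warped_metric_pos:
  assumes k: "\<kappa> \<in> {-1, 0, 1}" and q: "q \<in> warped_space \<kappa>" and v: "v \<in> warped_tangent \<kappa> q" and "v \<noteq> 0"
  shows "warped_metric \<kappa> f q v v > 0"
proof -
  obtain t s w where q': "q = (t, s, w)" by (metis surj_pair)
  obtain a b c where v': "v = (a, b, c)" by (metis surj_pair)
  have M: "s\<^sup>2 + \<kappa> * (norm w)\<^sup>2 = 1" and s: "\<kappa> \<le> 0 \<Longrightarrow> s > 0" and T: "s * b + \<kappa> * (w \<bullet> c) = 0"
    using q v by (auto simp: q' v' warped_space_def space_form_def warped_tangent_def space_form_tangent_def)
  have "\<kappa> * (b * b) + c \<bullet> c > 0" if "b \<noteq> 0 \<or> c \<noteq> 0"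
  proof -
    consider "\<kappa> = 1" | "\<kappa> = 0" | "\<kappa> = -1" using k by auto
    then show ?thesis
    proof cases
      case 1
      then show ?thesis using that
        by (metis add_nonneg_pos add_pos_nonneg inner_ge_zero inner_gt_zero_iff mult_1 not_real_square_gt_zero zero_le_square)
    next
      case 2
      then show ?thesis using that T s by auto
    next
      case 3
      have "(s * b)\<^sup>2 = (w \<bullet> c)\<^sup>2" using T 3 by simp
      also have "\<dots> \<le> (norm w)\<^sup>2 * (c \<bullet> c)"
        using Cauchy_Schwarz_ineq[of w c] by (simp add: dot_square_norm)
      also have "(norm w)\<^sup>2 = s\<^sup>2 - 1" using M 3 by simp
      finally have *: "s\<^sup>2 * b\<^sup>2 \<le> s\<^sup>2 * (c \<bullet> c) - c \<bullet> c" by (simp add: algebra_simps power_mult_distrib)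
      have "c \<noteq> 0"
      proof
        assume c: "c = 0"
        then have "s * b = 0" using T by simp
        then show False using s 3 that c by auto
      qed
      then have "s\<^sup>2 * b\<^sup>2 < s\<^sup>2 * (c \<bullet> c)" using * inner_gt_zero_iff[of c] by linarith
      moreover have "s\<^sup>2 > 0" using s 3 by simp
      ultimately show ?thesis using 3 by (simp add: power2_eq_square[of b])
    qed
  qed
  moreover have "warped_metric \<kappa> f q v v = a * a + exp (2 * f t) * (\<kappa> * (b * b) + c \<bullet> c)"
    by (simp add: q' v' warped_metric_def space_form_metric_def)
  moreover have "a * a > 0" if "b = 0" "c = 0"
    using \<open>v \<noteq> 0\<close> that zero_less_power2[of a] by (auto simp: v' zero_prod_def power2_eq_square)
  ultimately show ?thesis
    by (cases "b = 0 \<and> c = 0") (auto intro!: add_nonneg_pos mult_pos_pos)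
qed

lemma warped_tangent_iff:
  "v \<in> warped_tangent \<kappa> q \<longleftrightarrow>
    fst (snd q) * fst (snd v) + \<kappa> * (snd (snd q) \<bullet> snd (snd v)) = 0"
  by (cases v) (auto simp: warped_tangent_def space_form_tangent_def)

lemma subspace_warped_tangent: "subspace (warped_tangent \<kappa> q)"
proof (rule subspaceI)
  fix c :: real and v assume "v \<in> warped_tangent \<kappa> q"
  then have "c * (fst (snd q) * fst (snd v) + \<kappa> * (snd (snd q) \<bullet> snd (snd v))) = 0"
    by (simp add: warped_tangent_iff)
  then show "c *\<^sub>R v \<in> warped_tangent \<kappa> q"
    by (simp add: warped_tangent_iff algebra_simps)
qed (auto simp: warped_tangent_iff algebra_simps)

text \<open>Because \<kappa> cubed is \<kappa>, the tangency functional at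
  \<open>fiber_normal\<close> is the left side of the equation of the space form. The value 1
  normalises the projection in \<open>tangent_extension\<close> and shows that tangent spaces are
  proper.\<close>

lemma fiber_normal_eq_1:
  assumes "\<kappa> \<in> {-1, 0, 1}" "q \<in> warped_space \<kappa>"
  shows "fst (snd q) * fst (fiber_normal \<kappa> (snd q)) + \<kappa> * (snd (snd q) \<bullet> snd (fiber_normal \<kappa> (snd q))) = 1"
proof -
  have "fst (snd q) * fst (fiber_normal \<kappa> (snd q)) + \<kappa> * (snd (snd q) \<bullet> snd (fiber_normal \<kappa> (snd q)))
      = (fst (snd q))\<^sup>2 + (\<kappa> * \<kappa>\<^sup>2) * (norm (snd (snd q)))\<^sup>2"
    by (simp add: fiber_normal_def power2_eq_square[of "fst (snd q)"] dot_square_norm)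
  then show ?thesis
    using assms by (auto simp: kappa_cube warped_space_def space_form_def)
qed

lemma tangent_field_tangent_extension:
  assumes "\<kappa> \<in> {-1, 0, 1}"
  shows "tangent_field_on (warped_space \<kappa>) (warped_tangent \<kappa>) UNIV (tangent_extension \<kappa> v)"
  unfolding tangent_field_on_def
proof (intro conjI ballI smooth_tangent_extension open_UNIV)
  fix q assume "q \<in> UNIV \<inter> warped_space \<kappa>"
  define L where "L = fst (snd q) * fst (snd v) + \<kappa> * (snd (snd q) \<bullet> snd (snd v))"
  have "fst (snd q) * fst (snd (tangent_extension \<kappa> v q)) + \<kappa> * (snd (snd q) \<bullet> snd (snd (tangent_extension \<kappa> v q)))
     = L - L * (fst (snd q) * fst (fiber_normal \<kappa> (snd q)) + \<kappa> * (snd (snd q) \<bullet> snd (fiber_normal \<kappa> (snd q))))"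
    unfolding tangent_extension_def L_def[symmetric]
    by (simp add: algebra_simps) (simp add: L_def algebra_simps)
  also have "\<dots> = 0"
    using fiber_normal_eq_1[OF assms] \<open>q \<in> _\<close> by simp
  finally show "tangent_extension \<kappa> v q \<in> warped_tangent \<kappa> q"
    by (simp add: warped_tangent_iff)
qed

lemma tangent_extension_at:
  "v \<in> warped_tangent \<kappa> q \<Longrightarrow> tangent_extension \<kappa> v q = v"
  by (simp add: warped_tangent_iff tangent_extension_def)

lemma warped_metric_algebra:
  "warped_metric \<kappa> f q (u + v) w = warped_metric \<kappa> f q u w + warped_metric \<kappa> f q v w"
  "warped_metric \<kappa> f q w (u + v) = warped_metric \<kappa> f q w u + warped_metric \<kappa> f q w v"
  "warped_metric \<kappa> f q (u - v) w = warped_metric \<kappa> f q u w - warped_metric \<kappa> f q v w"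
  "warped_metric \<kappa> f q w (u - v) = warped_metric \<kappa> f q w u - warped_metric \<kappa> f q w v"
  "warped_metric \<kappa> f q (- u) w = - warped_metric \<kappa> f q u w"
  "warped_metric \<kappa> f q w (- u) = - warped_metric \<kappa> f q w u"
  "warped_metric \<kappa> f q (r *\<^sub>R u) w = r * warped_metric \<kappa> f q u w"
  "warped_metric \<kappa> f q w (r *\<^sub>R u) = r * warped_metric \<kappa> f q w u"
  by (simp_all add: warped_metric_def space_form_metric_def algebra_simps)

lemma warped_metric_commute: "warped_metric \<kappa> f q u v = warped_metric \<kappa> f q v u"
  by (simp add: warped_metric_def space_form_metric_commute mult.commute)

section \<open>Uniqueness of the torsion-free metric connection\<close>

lemma symmetric_skew_imp_zero:
  fixes c :: "'a \<Rightarrow> 'a \<Rightarrow> 'a \<Rightarrow> real"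
  assumes sym: "\<And>u v w. u \<in> T \<Longrightarrow> v \<in> T \<Longrightarrow> w \<in> T \<Longrightarrow> c u v w = c v u w"
    and skew: "\<And>u v w. u \<in> T \<Longrightarrow> v \<in> T \<Longrightarrow> w \<in> T \<Longrightarrow> c u v w = - c u w v"
    and "u \<in> T" "v \<in> T" "w \<in> T"
  shows "c u v w = 0"
proof -
  note 1 = assms(3-5)
  \<comment> \<open>Six swaps, alternately skew and symmetric, return the arguments to their order
    with the sign -1.\<close>
  show ?thesis
    using skew[OF 1(1,2,3)] sym[OF 1(1,3,2)] skew[OF 1(3,1,2)] sym[OF 1(3,2,1)] skew[OF 1(2,3,1)] sym[OF 1(1,2,3)]
    by linarith
qed

text \<open>The vector is a combination of \<open>u\<close>, \<open>v\<close> and a vertical vector;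
  \<open>c\<close> is free since vertical vectors are tangent.\<close>

lemma warped_christoffel_tangent_part:
  assumes "u \<in> warped_tangent \<kappa> q" "v \<in> warped_tangent \<kappa> q"
  shows "(c, deriv f (fst q) *\<^sub>R (fst u *\<^sub>R snd v + fst v *\<^sub>R snd u)) \<in> warped_tangent \<kappa> q"
proof -
  have "(c, deriv f (fst q) *\<^sub>R (fst u *\<^sub>R snd v + fst v *\<^sub>R snd u)) =
      (deriv f (fst q) * fst u) *\<^sub>R v + (deriv f (fst q) * fst v) *\<^sub>R u + (c - 2 * deriv f (fst q) * fst u * fst v, 0)"
    by (simp add: prod_eq_iff algebra_simps)
  moreover have "(d, 0) \<in> warped_tangent \<kappa> q" for d by (simp add: warped_tangent_iff)
  ultimately show ?thesis
    using assms subspace_warped_tangent by (metis subspace_add subspace_scale)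
qed

text \<open>The left side is what differentiating the tangency condition produces; the right side is
  how the connection tensor expresses it. For \<kappa> = 0 tangency of \<open>u\<close> makes both
  vanish, otherwise \<kappa> squared is 1.\<close>

lemma tangent_form_eq_metric:
  assumes "\<kappa> \<in> {-1, 0, 1}" "q \<in> warped_space \<kappa>" "u \<in> warped_tangent \<kappa> q"
  shows "fst (snd u) * fst (snd v) + \<kappa> * (snd (snd u) \<bullet> snd (snd v)) = \<kappa> * space_form_metric \<kappa> (snd u) (snd v)"
proof (cases "\<kappa> = 0")
  case True
  then have "fst (snd q) * fst (snd u) = 0" "fst (snd q) > 0"
    using assms by (auto simp: warped_tangent_iff warped_space_def space_form_def)
  then show ?thesis using True by simp
next
  case False
  then have "\<kappa> * \<kappa> = 1" using assms by auto
  then show ?thesis by (simp add: space_form_metric_def distrib_left flip: mult.assoc)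
qed

text \<open>Koszul uniqueness at one point. With the normal terms stripped off, both tensors are
  tangential, symmetric and subject to the same compatibility identity, so their difference is
  symmetric in the first two slots and skew in the last two.\<close>

lemma levi_civita_warped_christoffel:
  assumes k: "\<kappa> \<in> {-1, 0, 1}"
    and f: "f differentiable (at (fst q))"
    and LC: "levi_civita (warped_space \<kappa>) (warped_tangent \<kappa>) (warped_metric \<kappa> f) G"
    and q: "q \<in> warped_space \<kappa>" and u: "u \<in> warped_tangent \<kappa> q" and v: "v \<in> warped_tangent \<kappa> q"
  shows "G q u v = warped_christoffel \<kappa> f q u v"
proof -
  let ?T = "warped_tangent \<kappa> q" and ?g = "warped_metric \<kappa> f q"
  define L where "L u v = fst (snd u) * fst (snd v) + \<kappa> * (snd (snd u) \<bullet> snd (snd v))" for u v :: ambient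
  define n :: ambient where "n = (0, fiber_normal \<kappa> (snd q))"
  have L_sym: "L u v = L v u" for u v by (simp add: L_def inner_commute mult.commute)
  have T: "L q v = 0" if "v \<in> ?T" for v using that by (simp add: warped_tangent_iff L_def)
  have gn: "?g n v = 0" if "v \<in> ?T" for v
    using T[OF that]
    by (simp add: n_def warped_metric_def space_form_metric_fiber_normal L_def)
  have LC': "covariant_deriv G Y q (X q) \<in> ?T \<and>
      covariant_deriv G Y q (X q) - covariant_deriv G X q (Y q) = lie_bracket X Y q \<and>
      frechet_derivative (\<lambda>x. warped_metric \<kappa> f x (Y x) (Z x)) (at q) (X q) =
        ?g (covariant_deriv G Y q (X q)) (Z q) + ?g (Y q) (covariant_deriv G Z q (X q))"
    if "tangent_field_on (warped_space \<kappa>) (warped_tangent \<kappa>) UNIV X"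
       "tangent_field_on (warped_space \<kappa>) (warped_tangent \<kappa>) UNIV Y"
       "tangent_field_on (warped_space \<kappa>) (warped_tangent \<kappa>) UNIV Z" for X Y Z
    using LC[unfolded levi_civita_def, THEN conjunct2, rule_format, of UNIV X Y Z q] that q by simp
  \<comment> \<open>Of the two terms of the derivative, the one with coefficient
    \<open>L q v\<close> vanishes because \<open>v\<close> is tangent at \<open>q\<close>; the other
    is normal.\<close>
  have D: "frechet_derivative (tangent_extension \<kappa> v) (at q) u = - (L u v *\<^sub>R n)" if "v \<in> ?T" for u v
    using fun_cong[OF frechet_derivative_at[OF has_derivative_tangent_extension[of \<kappa> v q]], of u, symmetric] T[OF that]
    by (simp add: tangent_extension_part_def n_def L_def prod_eq_iff)
  define B where "B u v = G q u v - L u v *\<^sub>R n" for u v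
  have cov: "covariant_deriv G (tangent_extension \<kappa> v) q u = B u v" if "v \<in> ?T" for u v
    by (simp add: covariant_deriv_def D[OF that] tangent_extension_at[OF that] B_def)
  have B_tangent: "B u v \<in> ?T" if "u \<in> ?T" "v \<in> ?T" for u v
    using LC'[OF tangent_field_tangent_extension[OF k, of u] tangent_field_tangent_extension[OF k, of v]
        tangent_field_tangent_extension[OF k, of v], THEN conjunct1]
    by (simp add: that cov tangent_extension_at)
  have B_sym: "B u v = B v u" if "u \<in> ?T" "v \<in> ?T" for u v
    using LC'[OF tangent_field_tangent_extension[OF k, of u] tangent_field_tangent_extension[OF k, of v]
        tangent_field_tangent_extension[OF k, of v], THEN conjunct2, THEN conjunct1]
    by (simp add: that cov lie_bracket_def D tangent_extension_at L_sym[of v u])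
  have f': "(f has_real_derivative deriv f (fst q)) (at (fst q))"
    using f by (simp add: DERIV_deriv_iff_real_differentiable)
  \<comment> \<open>The left side is the derivative of the warping factor. The extended fields vary
    in the normal direction only, which the metric does not see against tangent vectors.\<close>
  have B_compat: "2 * deriv f (fst q) * fst u * exp (2 * f (fst q)) * space_form_metric \<kappa> (snd v) (snd w) =
      ?g (B u v) w + ?g v (B u w)" if "u \<in> ?T" "v \<in> ?T" "w \<in> ?T" for u v w
  proof -
    have Y: "(tangent_extension \<kappa> v has_derivative (\<lambda>u. - (L u v *\<^sub>R n))) (at q)" if "v \<in> ?T" for v
    proof -
      have "frechet_derivative (tangent_extension \<kappa> v) (at q) = (\<lambda>u. - (L u v *\<^sub>R n))"
        using D[OF that] by blast
      moreover have "(tangent_extension \<kappa> v has_derivative frechet_derivative (tangent_extension \<kappa> v) (at q)) (at q)"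
        using has_derivative_tangent_extension unfolding frechet_derivative_works[symmetric] differentiable_def by blast
      ultimately show ?thesis by simp
    qed
    have fd: "((\<lambda>x. f (fst x)) has_derivative (\<lambda>u. fst u * deriv f (fst q))) (at q)"
      by (rule DERIV_compose_FDERIV[where g = fst, OF f']) (intro derivative_intros)
    have "((\<lambda>x. warped_metric \<kappa> f x (tangent_extension \<kappa> v x) (tangent_extension \<kappa> w x)) has_derivative
      (\<lambda>u. 2 * deriv f (fst q) * fst u * exp (2 * f (fst q)) * space_form_metric \<kappa> (snd v) (snd w) +
        (?g (- (L u v *\<^sub>R n)) w + ?g v (- (L u w *\<^sub>R n))))) (at q)"
      unfolding warped_metric_def
      by (rule derivative_eq_intros fd Y that refl space_form_metric.FDERIV)+
         (simp add: fun_eq_iff tangent_extension_at that algebra_simps)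
    from fun_cong[OF frechet_derivative_at[OF this], of u]
    show ?thesis
      using LC'[OF tangent_field_tangent_extension[OF k, of u] tangent_field_tangent_extension[OF k, of v]
        tangent_field_tangent_extension[OF k, of w]]
        gn[OF that(2)] gn[OF that(3)]
      by (simp add: that cov tangent_extension_at warped_metric_algebra warped_metric_commute[of _ _ _ _ n])
  qed
  \<comment> \<open>The candidate for \<open>B\<close>: the explicit tensor without its normal
    term.\<close>
  define C :: "ambient \<Rightarrow> ambient \<Rightarrow> ambient" where
    "C u v = (- (deriv f (fst q) * exp (2 * f (fst q)) * space_form_metric \<kappa> (snd u) (snd v)),
      deriv f (fst q) *\<^sub>R (fst u *\<^sub>R snd v + fst v *\<^sub>R snd u))" for u v
  have C_tangent: "C u v \<in> ?T" if "u \<in> ?T" "v \<in> ?T" for u v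
    unfolding C_def by (rule warped_christoffel_tangent_part[OF that])
  have C_sym: "C u v = C v u" for u v
    by (simp add: C_def space_form_metric_commute[of _ "snd u"] add.commute)
  have C_compat: "2 * deriv f (fst q) * fst u * exp (2 * f (fst q)) * space_form_metric \<kappa> (snd v) (snd w) =
      ?g (C u v) w + ?g v (C u w)" for u v w
    by (simp add: C_def warped_metric_def space_form_metric.add_left space_form_metric.add_right
        space_form_metric.scaleR_left space_form_metric.scaleR_right algebra_simps
        space_form_metric_commute[of _ "snd v"] space_form_metric_commute[of _ "snd w" "snd u"])
  define E where "E u v w = ?g (B u v - C u v) w" for u v w
  have zero: "E u v w = 0" if "w \<in> ?T" for w
  proof (rule symmetric_skew_imp_zero[of ?T E, OF _ _ u v that])
    show "E u v w = E v u w" if "u \<in> ?T" "v \<in> ?T" "w \<in> ?T" for u v w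
      using that by (simp add: E_def B_sym[of u v] C_sym[of u v])
    show "E u v w = - E u w v" if "u \<in> ?T" "v \<in> ?T" "w \<in> ?T" for u v w
      using B_compat[OF that] C_compat[of u v w]
      by (simp add: E_def warped_metric_algebra warped_metric_commute[of _ _ _ v])
  qed
  \<comment> \<open>The difference is tangent and orthogonal to all tangent vectors, itself
    included, so definiteness on the tangent space makes it zero.\<close>
  have "B u v - C u v \<in> ?T"
    using B_tangent C_tangent u v subspace_warped_tangent subspace_diff by blast
  with zero[OF this] have "B u v = C u v"
    unfolding E_def using warped_metric_pos[OF k q, of "B u v - C u v" f] by fastforce
  moreover have "L u v *\<^sub>R n = (0, (\<kappa> * space_form_metric \<kappa> (snd u) (snd v)) *\<^sub>R fiber_normal \<kappa> (snd q))"
  proof -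
    have "L u v = \<kappa> * space_form_metric \<kappa> (snd u) (snd v)"
      unfolding L_def by (rule tangent_form_eq_metric[OF k q u])
    then show ?thesis by (simp add: n_def)
  qed
  ultimately show ?thesis
    by (simp add: B_def C_def warped_christoffel_def diff_eq_eq)
qed

section \<open>Conformal immersions with a unit normal\<close>

lemma smooth_real_derivs:
  fixes f :: "real \<Rightarrow> real"
  assumes "smooth_on UNIV f"
  shows "(f has_real_derivative deriv f t) (at t)"
    and "(deriv f has_real_derivative deriv (deriv f) t) (at t)"
proof -
  have diff: "f differentiable (at t)" for t
    using smooth_on_differentiable[OF assms] by simp
  have f: "(f has_real_derivative deriv f t) (at t)" for t
    using diff by (simp add: DERIV_deriv_iff_real_differentiable)
  show "(f has_real_derivative deriv f t) (at t)" by (rule f)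
  have "deriv f = dird 1 f"
  proof
    fix t
    show "deriv f t = dird 1 f t"
      using dird_eq[OF f[unfolded has_field_derivative_def]] by simp
  qed
  then have "deriv f differentiable (at t)"
    using smooth_on_differentiable[OF smooth_on_dird[OF assms]] by simp
  then show "(deriv f has_real_derivative deriv (deriv f) t) (at t)"
    by (simp add: DERIV_deriv_iff_real_differentiable)
qed

lemma warped_christoffel_commute: "warped_christoffel \<kappa> f q u v = warped_christoffel \<kappa> f q v u"
  by (simp add: warped_christoffel_def space_form_metric_commute[of _ "snd u"] add.commute)

lemma bounded_linear_fiber_normal: "bounded_linear (fiber_normal \<kappa>)"
  unfolding linear_conv_bounded_linear[symmetric]
  by (auto intro!: linearI simp: fiber_normal_def algebra_simps)

lemma space_form_metric_normal_tangent:
  assumes "v \<in> warped_tangent \<kappa> q"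
  shows "space_form_metric \<kappa> (fiber_normal \<kappa> (snd q)) (snd v) = 0"
    and "space_form_metric \<kappa> (snd v) (fiber_normal \<kappa> (snd q)) = 0"
  using assms by (simp_all add: space_form_metric_fiber_normal warped_tangent_iff
      space_form_metric_commute[of _ "snd v"])

lemmas space_form_metric_linear =
  space_form_metric.add_left space_form_metric.add_right space_form_metric.diff_left
  space_form_metric.diff_right space_form_metric.minus_left space_form_metric.minus_right
  space_form_metric.scaleR_left space_form_metric.scaleR_right

text \<open>The local data carry no \<open>G\<close>: on tangent vectors it agrees with
  \<open>warped_christoffel\<close>, which takes its place. Positivity and differentiability of
  \<rho> are derived from the conformality identity.\<close>

locale conformal_immersion =
  fixes \<kappa> :: real and f :: "real \<Rightarrow> real" and \<Omega> :: "complex set"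
    and X n :: "complex \<Rightarrow> ambient" and \<rho> :: "complex \<Rightarrow> real"
  assumes kappa: "\<kappa> \<in> {-1, 0, 1}"
    and smooth_f: "smooth_on UNIV f"
    and open_dom: "open \<Omega>"
    and smooth_X: "smooth_on \<Omega> X"
    and smooth_n: "smooth_on \<Omega> n"
    and X_in: "\<And>w. w \<in> \<Omega> \<Longrightarrow> X w \<in> warped_space \<kappa>"
    and n_tangent: "\<And>w. w \<in> \<Omega> \<Longrightarrow> n w \<in> warped_tangent \<kappa> (X w)"
    and n_unit: "\<And>w. w \<in> \<Omega> \<Longrightarrow> warped_metric \<kappa> f (X w) (n w) (n w) = 1"
    and e_normal: "\<And>w u. w \<in> \<Omega> \<Longrightarrow> warped_metric \<kappa> f (X w) (dird u X w) (n w) = 0"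
    and conformal: "\<And>w u v. w \<in> \<Omega> \<Longrightarrow>
      warped_metric \<kappa> f (X w) (dird u X w) (dird v X w) = \<rho> w * (u \<bullet> v)"
    and immersed: "\<And>w. w \<in> \<Omega> \<Longrightarrow> inj (\<lambda>u. dird u X w)"
begin

abbreviation g where "g w \<equiv> warped_metric \<kappa> f (X w)"
abbreviation T where "T w \<equiv> warped_tangent \<kappa> (X w)"
abbreviation e where "e u \<equiv> dird u X"
abbreviation B where "B u v \<equiv> space_form_metric \<kappa> (snd u) (snd v)"

text \<open>Being explicit in \<open>w\<close>, the tensor can be differentiated once more, which is
  how curvature is obtained.\<close>

definition nabla :: "complex \<Rightarrow> (complex \<Rightarrow> ambient) \<Rightarrow> complex \<Rightarrow> ambient" where
  "nabla u Y w = dird u Y w + warped_christoffel \<kappa> f (X w) (e u w) (Y w)"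

section \<open>The covariant derivative along the immersion and the adapted frame\<close>

lemma e_has_derivative: "w \<in> \<Omega> \<Longrightarrow> (X has_derivative (\<lambda>u. e u w)) (at w)"
  by (rule smooth_on_has_derivative[OF smooth_X])

lemma linear_e: "w \<in> \<Omega> \<Longrightarrow> linear (\<lambda>u. e u w)"
  using e_has_derivative has_derivative_linear by blast

lemma nabla_tangent_eq:
  assumes w: "w \<in> \<Omega>" and Y: "Y differentiable (at w)" and tan: "\<And>x. x \<in> \<Omega> \<Longrightarrow> Y x \<in> T x"
  shows "fst (snd (e u w)) * fst (snd (Y w)) + \<kappa> * (snd (snd (e u w)) \<bullet> snd (snd (Y w))) +
    (fst (snd (X w)) * fst (snd (dird u Y w)) + \<kappa> * (snd (snd (X w)) \<bullet> snd (snd (dird u Y w)))) = 0"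
proof -
  note dX = e_has_derivative[OF w] and dY = has_derivative_dird[OF Y]
  have 1: "((\<lambda>w. fst (snd (X w)) * fst (snd (Y w)) + \<kappa> * (snd (snd (X w)) \<bullet> snd (snd (Y w)))) has_derivative
    (\<lambda>u. fst (snd (e u w)) * fst (snd (Y w)) + \<kappa> * (snd (snd (e u w)) \<bullet> snd (snd (Y w))) +
    (fst (snd (X w)) * fst (snd (dird u Y w)) + \<kappa> * (snd (snd (X w)) \<bullet> snd (snd (dird u Y w)))))) (at w)"
    by (rule derivative_eq_intros dX dY refl)+ (simp add: algebra_simps)
  have 2: "((\<lambda>w. fst (snd (X w)) * fst (snd (Y w)) + \<kappa> * (snd (snd (X w)) \<bullet> snd (snd (Y w)))) has_derivative
     (\<lambda>_. 0)) (at w)"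
    by (rule has_derivative_transform_within_open[OF has_derivative_const[of 0] open_dom w])
       (use tan in \<open>auto simp: warped_tangent_iff\<close>)
  show ?thesis using fun_cong[OF has_derivative_unique[OF 1 2], of u] .
qed

lemma e_tangent:
  assumes w: "w \<in> \<Omega>"
  shows "e u w \<in> T w"
proof -
  note dX = e_has_derivative[OF w]
  have 1: "((\<lambda>w. fst (snd (X w)) * fst (snd (X w)) + \<kappa> * (snd (snd (X w)) \<bullet> snd (snd (X w)))) has_derivative
    (\<lambda>u. 2 * (fst (snd (X w)) * fst (snd (e u w)) + \<kappa> * (snd (snd (X w)) \<bullet> snd (snd (e u w)))))) (at w)"
    by (rule derivative_eq_intros dX refl)+ (simp add: algebra_simps inner_commute)
  have 2: "((\<lambda>w. fst (snd (X w)) * fst (snd (X w)) + \<kappa> * (snd (snd (X w)) \<bullet> snd (snd (X w)))) has_derivative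
     (\<lambda>_. 0)) (at w)"
    by (rule has_derivative_transform_within_open[OF has_derivative_const[of 1] open_dom w])
       (use X_in in \<open>force simp: warped_space_def space_form_def power2_eq_square dot_square_norm\<close>)
  have "2 * (fst (snd (X w)) * fst (snd (e u w)) + \<kappa> * (snd (snd (X w)) \<bullet> snd (snd (e u w)))) = 0"
    using fun_cong[OF has_derivative_unique[OF 1 2], of u] .
  then show ?thesis by (simp add: warped_tangent_iff)
qed

lemma rho_pos:
  assumes w: "w \<in> \<Omega>"
  shows "\<rho> w > 0"
proof -
  have "e 0 w = 0" using linear_0[OF linear_e[OF w]] .
  then have "e 1 w \<noteq> 0" using immersed[OF w] by (metis injD zero_neq_one)
  then have "g w (e 1 w) (e 1 w) > 0"
    using warped_metric_pos kappa X_in w e_tangent by blast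
  then show ?thesis by (simp add: conformal[OF w])
qed

text \<open>The flat derivative of \<open>Y\<close> leaves the tangent space by the amount found in
  \<open>nabla_tangent_eq\<close>; the \<kappa> term of the tensor, along a vector on which the
  functional is 1, compensates exactly that.\<close>

lemma nabla_in_T:
  assumes w: "w \<in> \<Omega>" and Y: "Y differentiable (at w)" and tan: "\<And>x. x \<in> \<Omega> \<Longrightarrow> Y x \<in> T x"
  shows "nabla u Y w \<in> T w"
proof -
  define L where "L u v = fst (snd u) * fst (snd v) + \<kappa> * (snd (snd u) \<bullet> snd (snd v))" for u v :: ambient
  have T: "v \<in> T w \<longleftrightarrow> L (X w) v = 0" for v by (simp add: L_def warped_tangent_iff)
  have L_linear: "L a (b + c) = L a b + L a c" "L a (r *\<^sub>R b) = r * L a b" for a b c r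
    by (simp_all add: L_def algebra_simps)
  define m :: ambient where "m = (0, fiber_normal \<kappa> (snd (X w)))"
  have "L (X w) m = 1"
    using fiber_normal_eq_1[OF kappa X_in[OF w]] by (simp add: L_def m_def)
  moreover have "L (e u w) (Y w) + L (X w) (dird u Y w) = 0"
    using nabla_tangent_eq[OF w Y tan] by (simp add: L_def)
  moreover have "L (e u w) (Y w) = \<kappa> * B (e u w) (Y w)"
    using tangent_form_eq_metric[OF kappa X_in[OF w] e_tangent[OF w]] by (simp add: L_def)
  moreover have "nabla u Y w = dird u Y w + (\<kappa> * B (e u w) (Y w)) *\<^sub>R m +
     (- (deriv f (fst (X w)) * exp (2 * f (fst (X w))) * B (e u w) (Y w)), deriv f (fst (X w)) *\<^sub>R (fst (e u w) *\<^sub>R snd (Y w) + fst (Y w) *\<^sub>R snd (e u w)))"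
    by (simp add: nabla_def warped_christoffel_def m_def)
  moreover have "L (X w) (c, deriv f (fst (X w)) *\<^sub>R (fst (e u w) *\<^sub>R snd (Y w) + fst (Y w) *\<^sub>R snd (e u w))) = 0" for c
    using warped_christoffel_tangent_part[OF e_tangent[OF w] tan[OF w]] by (simp add: T)
  ultimately show ?thesis by (simp add: T L_linear)
qed

lemma height_has_derivative:
  assumes w: "w \<in> \<Omega>"
  shows "((\<lambda>w. fst (X w)) has_derivative (\<lambda>u. fst (e u w))) (at w)"
  using has_derivative_fst[OF e_has_derivative[OF w]] .

lemma f_has_derivative:
  assumes w: "w \<in> \<Omega>"
  shows "((\<lambda>w. f (fst (X w))) has_derivative (\<lambda>u. fst (e u w) * deriv f (fst (X w)))) (at w)"
    and "((\<lambda>w. deriv f (fst (X w))) has_derivative (\<lambda>u. fst (e u w) * deriv (deriv f) (fst (X w)))) (at w)"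
  using DERIV_compose_FDERIV[where g = "\<lambda>w. fst (X w)", OF smooth_real_derivs(1)[OF smooth_f] height_has_derivative[OF w]]
    DERIV_compose_FDERIV[where g = "\<lambda>w. fst (X w)", OF smooth_real_derivs(2)[OF smooth_f] height_has_derivative[OF w]]
  by simp_all

text \<open>The derivative of the warping factor is matched by the \<open>deriv f\<close> terms of
  the tensor, while the normal term of one field is orthogonal to the other; for this, tangency at
  the single point \<open>w\<close> is enough.\<close>

lemma metric_compat:
  assumes w: "w \<in> \<Omega>" and Y: "Y differentiable (at w)" and Z: "Z differentiable (at w)"
    and tan: "Y w \<in> T w" "Z w \<in> T w"
  shows "((\<lambda>w. g w (Y w) (Z w)) has_derivative
    (\<lambda>u. g w (nabla u Y w) (Z w) + g w (Y w) (nabla u Z w))) (at w)"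
proof -
  note dY = has_derivative_dird[OF Y] and dZ = has_derivative_dird[OF Z]
  note n0 = space_form_metric_normal_tangent[OF tan(1)] space_form_metric_normal_tangent[OF tan(2)]
  show ?thesis
    unfolding warped_metric_def
    by (rule derivative_eq_intros f_has_derivative[OF w] dY dZ refl space_form_metric.FDERIV)+
      (simp add: fun_eq_iff nabla_def warped_christoffel_def space_form_metric_linear n0 algebra_simps
        space_form_metric_commute[of _ "snd (Y w)" "snd (e _ w)"])
qed

lemma nabla_e_commute:
  assumes w: "w \<in> \<Omega>"
  shows "nabla u (e v) w = nabla v (e u) w"
  using dird_dird_commute[OF open_dom smooth_X w, of u v]
  by (simp add: nabla_def warped_christoffel_commute[of _ _ _ "e u w"])

lemma vertical_tangent: "vertical_field \<in> T w"
  by (simp add: vertical_field_def warped_tangent_iff)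

lemma g_vertical: "g w vertical_field v = fst v"
  by (simp add: vertical_field_def warped_metric_def space_form_metric_def)

lemma nabla_vertical:
  "nabla u (\<lambda>_. vertical_field) w = deriv f (fst (X w)) *\<^sub>R (e u w - fst (e u w) *\<^sub>R vertical_field)"
  using dird_eq[OF has_derivative_const, of u vertical_field w]
  by (simp add: nabla_def warped_christoffel_def vertical_field_def space_form_metric_def
      prod_eq_iff zero_prod_def[symmetric])

lemma normal_e: "w \<in> \<Omega> \<Longrightarrow> g w (n w) (e u w) = 0"
  using e_normal[of w u] warped_metric_commute[of \<kappa> f "X w" "n w" "e u w"] by simp

text \<open>Three orthogonal vectors of positive length are independent, and the tangent space has
  dimension at most 3, so they span it; the coefficients are read off by pairing.\<close>

lemma frame_expansion:
  assumes w: "w \<in> \<Omega>" and v: "v \<in> T w"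
  shows "v = (g w v (e 1 w) / \<rho> w) *\<^sub>R e 1 w + (g w v (e \<i> w) / \<rho> w) *\<^sub>R e \<i> w + g w v (n w) *\<^sub>R n w"
proof -
  let ?b1 = "e 1 w" and ?b2 = "e \<i> w" and ?b3 = "n w"
  have gb: "g w ?b1 ?b1 = \<rho> w" "g w ?b1 ?b2 = 0" "g w ?b1 ?b3 = 0"
      "g w ?b2 ?b1 = 0" "g w ?b2 ?b2 = \<rho> w" "g w ?b2 ?b3 = 0"
      "g w ?b3 ?b1 = 0" "g w ?b3 ?b2 = 0" "g w ?b3 ?b3 = 1"
    by (simp_all add: conformal[OF w] e_normal[OF w] normal_e[OF w] n_unit[OF w])
  note rho = rho_pos[OF w]
  have ne: "?b1 \<noteq> ?b2" "?b1 \<noteq> ?b3" "?b2 \<noteq> ?b3" using gb rho by auto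
  have zero: "a = 0 \<and> b = 0 \<and> c = 0" if "a *\<^sub>R ?b1 + b *\<^sub>R ?b2 + c *\<^sub>R ?b3 = 0" for a b c
  proof -
    have "g w (a *\<^sub>R ?b1 + b *\<^sub>R ?b2 + c *\<^sub>R ?b3) y = 0" for y
      unfolding that by (simp add: warped_metric_def space_form_metric_def)
    from this[of ?b1] this[of ?b2] this[of ?b3] show ?thesis
      using rho by (simp add: warped_metric_algebra gb)
  qed
  have "independent {?b1, ?b2, ?b3}"
  proof (rule independent_if_scalars_zero)
    fix c x assume s: "(\<Sum>x\<in>{?b1, ?b2, ?b3}. c x *\<^sub>R x) = 0" and x: "x \<in> {?b1, ?b2, ?b3}"
    have "c ?b1 *\<^sub>R ?b1 + c ?b2 *\<^sub>R ?b2 + c ?b3 *\<^sub>R ?b3 = 0" using s ne by (simp add: add.assoc)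
    from zero[OF this] x show "c x = 0" by auto
  qed simp
  moreover have "dim (T w) \<le> card {?b1, ?b2, ?b3}"
  proof -
    \<comment> \<open>A vector outside the tangent space: this proper subspace of a four-dimensional
      space has dimension at most 3.\<close>
    define m :: ambient where "m = (0, fiber_normal \<kappa> (snd (X w)))"
    have "m \<notin> T w"
      using fiber_normal_eq_1[OF kappa X_in[OF w]] by (simp add: m_def warped_tangent_iff)
    then have "T w \<noteq> UNIV" by blast
    then have "dim (T w) \<noteq> DIM(ambient)"
      using dim_eq_full[of "T w"] span_eq_iff[THEN iffD2, OF subspace_warped_tangent] by metis
    moreover have "dim (T w) \<le> DIM(ambient)" by (rule dim_subset_UNIV)
    ultimately show ?thesis using ne by simp
  qed
  ultimately have "T w \<subseteq> span {?b1, ?b2, ?b3}"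
    by (intro card_ge_dim_independent) (use e_tangent[OF w] n_tangent[OF w] in auto)
  with v have "v \<in> span {?b1, ?b2, ?b3}" by blast
  then obtain a b c where vv: "v = a *\<^sub>R ?b1 + b *\<^sub>R ?b2 + c *\<^sub>R ?b3"
    unfolding span_insert span_empty
    by (auto simp: algebra_simps)
  have "a = g w v ?b1 / \<rho> w" "b = g w v ?b2 / \<rho> w" "c = g w v ?b3"
    using rho unfolding vv by (simp_all add: warped_metric_algebra gb)
  with vv show ?thesis by simp
qed

lemma parseval:
  assumes w: "w \<in> \<Omega>" and v: "v \<in> T w"
  shows "g w v y = (g w v (e 1 w) * g w y (e 1 w) + g w v (e \<i> w) * g w y (e \<i> w)) / \<rho> w
    + g w v (n w) * g w y (n w)"
  by (subst frame_expansion[OF w v])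
     (simp add: warped_metric_algebra warped_metric_commute[of _ _ _ y] add_divide_distrib)

section \<open>Curvature along the immersion and the Codazzi equation\<close>

lemma christoffel_has_derivative:
  assumes w: "w \<in> \<Omega>" and P: "P differentiable (at w)" and Q: "Q differentiable (at w)"
  shows "((\<lambda>w. warped_christoffel \<kappa> f (X w) (P w) (Q w)) has_derivative
    (\<lambda>u. (- ((deriv (deriv f) (fst (X w)) + 2 * (deriv f (fst (X w)))\<^sup>2) * fst (e u w) * exp (2 * f (fst (X w))) * B (P w) (Q w)
          + deriv f (fst (X w)) * exp (2 * f (fst (X w))) * (B (dird u P w) (Q w) + B (P w) (dird u Q w))),
      (\<kappa> * (B (dird u P w) (Q w) + B (P w) (dird u Q w))) *\<^sub>R fiber_normal \<kappa> (snd (X w))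
      + B (P w) (Q w) *\<^sub>R (\<kappa> *\<^sub>R snd (e u w))
      + (deriv (deriv f) (fst (X w)) * fst (e u w)) *\<^sub>R (fst (P w) *\<^sub>R snd (Q w) + fst (Q w) *\<^sub>R snd (P w))
      + deriv f (fst (X w)) *\<^sub>R (fst (dird u P w) *\<^sub>R snd (Q w) + fst (P w) *\<^sub>R snd (dird u Q w)
         + fst (dird u Q w) *\<^sub>R snd (P w) + fst (Q w) *\<^sub>R snd (dird u P w))))) (at w)"
proof -
  note dP = has_derivative_dird[OF P] and dQ = has_derivative_dird[OF Q]
  have dN: "((\<lambda>w. fiber_normal \<kappa> (snd (X w))) has_derivative (\<lambda>u. fiber_normal \<kappa> (snd (e u w)))) (at w)"
    by (rule bounded_linear.has_derivative[OF bounded_linear_fiber_normal has_derivative_snd[OF e_has_derivative[OF w]]])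
  \<comment> \<open>Lets the derivative of \<open>fiber_normal\<close>, which always carries a
    factor \<kappa>, be replaced by that of the position vector.\<close>
  have k: "(\<kappa> * c) *\<^sub>R fiber_normal \<kappa> q = c *\<^sub>R (\<kappa> *\<^sub>R q)" for c q
    using kappa_fiber_normal[OF kappa, of q] by (metis mult.commute scaleR_scaleR)
  show ?thesis
    unfolding warped_christoffel_def
    by (rule derivative_eq_intros f_has_derivative[OF w] dP dQ dN refl space_form_metric.FDERIV)+
      (simp add: fun_eq_iff k algebra_simps power2_eq_square)
qed

lemma smooth_e: "smooth_on \<Omega> (e u)"
  by (rule smooth_on_dird[OF smooth_X])

lemma e_differentiable: "w \<in> \<Omega> \<Longrightarrow> e u differentiable (at w)"
  by (rule smooth_on_differentiable[OF smooth_e])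

lemma n_differentiable: "w \<in> \<Omega> \<Longrightarrow> n differentiable (at w)"
  by (rule smooth_on_differentiable[OF smooth_n])

lemma nabla_differentiable:
  assumes w: "w \<in> \<Omega>" and Y: "smooth_on \<Omega> Y"
  shows "nabla u Y differentiable (at w)"
proof -
  have "(\<lambda>w. warped_christoffel \<kappa> f (X w) (e u w) (Y w)) differentiable (at w)"
    using christoffel_has_derivative[OF w e_differentiable[OF w] smooth_on_differentiable[OF Y w]]
    by (rule differentiableI)
  then show ?thesis
    unfolding nabla_def[abs_def]
    by (intro differentiable_add smooth_on_differentiable[OF smooth_on_dird[OF Y] w])
qed

text \<open>The coefficients are the sectional curvatures: planes containing the vertical direction
  have curvature \<open>- (d2 + d1\<^sup>2)\<close>, fibre planes have
  \<open>\<kappa> / E - d1\<^sup>2\<close>. Pairing with the normal discards every multiple of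
  \<open>fiber_normal\<close>.\<close>

lemma curvature_normal_component:
  assumes w: "w \<in> \<Omega>" and Y: "smooth_on \<Omega> Y" and tan: "Y w \<in> T w"
  defines "E \<equiv> exp (2 * f (fst (X w)))" and "d1 \<equiv> deriv f (fst (X w))" and "d2 \<equiv> deriv (deriv f) (fst (X w))"
  shows "g w (nabla u (nabla v Y) w - nabla v (nabla u Y) w) (n w) =
    - (d2 + d1\<^sup>2) * E * (fst (e u w) * B (e v w) (Y w) - fst (e v w) * B (e u w) (Y w)) * fst (n w)
    + (\<kappa> - d1\<^sup>2 * E) * E * (B (e v w) (Y w) * B (e u w) (n w) - B (e u w) (Y w) * B (e v w) (n w))
    + (d2 + d1\<^sup>2) * fst (Y w) * E * (fst (e u w) * B (e v w) (n w) - fst (e v w) * B (e u w) (n w))"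
proof -
  define h where "h u = fst (e u w)" for u
  define q where "q u = snd (e u w)" for u
  define yt where "yt = fst (Y w)"
  define y where "y = snd (Y w)"
  define yt' where "yt' u = fst (dird u Y w)" for u
  define y' where "y' u = snd (dird u Y w)" for u
  define ht where "ht = fst (dird u (e v) w)"
  define qt where "qt = snd (dird u (e v) w)"
  define N where "N = fiber_normal \<kappa> (snd (X w))"
  define \<nu> where "\<nu> = fst (n w)"
  define \<eta> where "\<eta> = snd (n w)"
  note defs = h_def q_def yt_def y_def yt'_def y'_def ht_def qt_def N_def \<nu>_def \<eta>_def E_def d1_def d2_def
  let ?b = "space_form_metric \<kappa>"
  have sym: "dird v (e u) w = dird u (e v) w"
    by (rule dird_dird_commute[OF open_dom smooth_X w])
  have sym2: "dird v (dird u Y) w = dird u (dird v Y) w"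
    by (rule dird_dird_commute[OF open_dom Y w])
  note tangent_zero = space_form_metric_normal_tangent[OF e_tangent[OF w], folded q_def N_def]
    space_form_metric_normal_tangent[OF n_tangent[OF w], folded N_def \<eta>_def]
    space_form_metric_normal_tangent[OF tan, folded N_def y_def]
  have D: "dird u (nabla v Y) w = dird u (dird v Y) w +
    (- ((d2 + 2 * d1\<^sup>2) * fst (e u w) * E * B (e v w) (Y w)
          + d1 * E * (B (dird u (e v) w) (Y w) + B (e v w) (dird u Y w))),
      (\<kappa> * (B (dird u (e v) w) (Y w) + B (e v w) (dird u Y w))) *\<^sub>R N
      + B (e v w) (Y w) *\<^sub>R (\<kappa> *\<^sub>R snd (e u w))
      + (d2 * fst (e u w)) *\<^sub>R (fst (e v w) *\<^sub>R snd (Y w) + fst (Y w) *\<^sub>R snd (e v w))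
      + d1 *\<^sub>R (fst (dird u (e v) w) *\<^sub>R snd (Y w) + fst (e v w) *\<^sub>R snd (dird u Y w)
         + fst (dird u Y w) *\<^sub>R snd (e v w) + fst (Y w) *\<^sub>R snd (dird u (e v) w)))" for u v
    unfolding nabla_def[abs_def] E_def d1_def d2_def N_def
    by (rule dird_eq[OF has_derivative_add[OF
        smooth_on_has_derivative[OF smooth_on_dird[OF Y] w]
        christoffel_has_derivative[OF w e_differentiable[OF w] smooth_on_differentiable[OF Y w]]]])
  have N2: "nabla u (nabla v Y) w = dird u (nabla v Y) w +
     warped_christoffel \<kappa> f (X w) (e u w) (dird v Y w + warped_christoffel \<kappa> f (X w) (e v w) (Y w))" for u v
    by (simp add: nabla_def[of u "nabla v Y"] nabla_def[of v Y])
  \<comment> \<open>The vertical component, and then the fibre component paired with the normal, are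
    computed separately. The first derivatives of \<open>Y\<close> and the mixed second derivatives
    cancel under exchange of \<open>u\<close> and \<open>v\<close>.\<close>
  have F: "fst (nabla u (nabla v Y) w) - fst (nabla v (nabla u Y) w) =
     - (d2 + d1\<^sup>2) * E * (h u * ?b (q v) y - h v * ?b (q u) y)"
    unfolding N2 D sym sym2
    by (simp add: warped_christoffel_def E_def[symmetric] d1_def[symmetric] N_def[symmetric]
        q_def[symmetric] y_def[symmetric] y'_def[symmetric] qt_def[symmetric] h_def[symmetric] yt_def[symmetric]
        space_form_metric_linear tangent_zero space_form_metric_commute[of _ "q v" "q u"])
      (simp add: algebra_simps power2_eq_square)
  have S: "?b (snd (nabla u (nabla v Y) w) - snd (nabla v (nabla u Y) w)) \<eta> =
     (\<kappa> - d1\<^sup>2 * E) * (?b (q v) y * ?b (q u) \<eta> - ?b (q u) y * ?b (q v) \<eta>)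
    + (d2 + d1\<^sup>2) * yt * (h u * ?b (q v) \<eta> - h v * ?b (q u) \<eta>)"
    unfolding N2 D sym sym2
    by (simp add: warped_christoffel_def E_def[symmetric] d1_def[symmetric] N_def[symmetric]
        q_def[symmetric] y_def[symmetric] y'_def[symmetric] qt_def[symmetric] h_def[symmetric]
        yt_def[symmetric] yt'_def[symmetric] ht_def[symmetric]
        space_form_metric_linear tangent_zero space_form_metric_commute[of _ "q v" "q u"])
      (simp add: algebra_simps power2_eq_square)
  have "g w (nabla u (nabla v Y) w - nabla v (nabla u Y) w) (n w) =
     (fst (nabla u (nabla v Y) w) - fst (nabla v (nabla u Y) w)) * \<nu>
      + E * ?b (snd (nabla u (nabla v Y) w) - snd (nabla v (nabla u Y) w)) \<eta>"
    by (simp add: warped_metric_def E_def \<nu>_def \<eta>_def)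
  also have "\<dots> = - (d2 + d1\<^sup>2) * E * (h u * ?b (q v) y - h v * ?b (q u) y) * \<nu>
    + (\<kappa> - d1\<^sup>2 * E) * E * (?b (q v) y * ?b (q u) \<eta> - ?b (q u) y * ?b (q v) \<eta>)
    + (d2 + d1\<^sup>2) * yt * E * (h u * ?b (q v) \<eta> - h v * ?b (q u) \<eta>)"
    unfolding F S by (simp add: algebra_simps)
  finally show ?thesis by (simp only: h_def q_def y_def yt_def \<nu>_def \<eta>_def)
qed

text \<open>A constant-curvature tensor has no normal component on three tangent vectors of the
  surface. Only the difference of the fibre and vertical curvatures survives: \<open>deriv f\<close>
  squared cancels and \<open>f'' + \<kappa> * exp (- 2 * f)\<close> remains.\<close>

lemma curvature_e:
  assumes w: "w \<in> \<Omega>"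
  shows "g w (nabla u (nabla v (e r)) w - nabla v (nabla u (e r)) w) (n w) =
    - (deriv (deriv f) (fst (X w)) + \<kappa> * exp (- 2 * f (fst (X w)))) * fst (n w) * \<rho> w *
      (fst (e u w) * (v \<bullet> r) - fst (e v w) * (u \<bullet> r))"
proof -
  define E where "E = exp (2 * f (fst (X w)))"
  define K where "K = exp (- 2 * f (fst (X w)))"
  have EK: "E * K = 1" by (simp add: E_def K_def flip: exp_add)
  have 1: "E * B (e u w) (n w) = - fst (e u w) * fst (n w)" for u
    using e_normal[OF w, of u] by (simp add: warped_metric_def E_def)
  have 2: "E * B (e u w) (e v w) = \<rho> w * (u \<bullet> v) - fst (e u w) * fst (e v w)" for u v
    using conformal[OF w, of u v] by (simp add: warped_metric_def E_def)
  \<comment> \<open>Each pairing needs its own factor \<open>E\<close> to be rewritten by facts 1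
    and 2, but a product of two pairings carries only one; the missing factor is supplied and paid
    for by \<open>K\<close>.\<close>
  have 3: "E * (B (e v w) (e r w) * B (e u w) (n w) - B (e u w) (e r w) * B (e v w) (n w)) =
      K * (- fst (n w) * \<rho> w * (fst (e u w) * (v \<bullet> r) - fst (e v w) * (u \<bullet> r)))"
    (is "?l = K * ?r")
  proof -
    have "E * ?l = (E * B (e v w) (e r w)) * (E * B (e u w) (n w)) - (E * B (e u w) (e r w)) * (E * B (e v w) (n w))"
      by (simp add: algebra_simps)
    also have "\<dots> = ?r" unfolding 1 2 by (simp add: algebra_simps)
    finally have l: "E * ?l = ?r" .
    have "E * ?l = (E * K) * (E * ?l)" by (simp only: EK mult_1)
    also have "\<dots> = E * (K * (E * ?l))" by (simp only: mult.assoc)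
    finally have "?l = K * (E * ?l)" by (simp add: E_def)
    then show ?thesis by (simp only: l)
  qed
  let ?d1 = "deriv f (fst (X w))" and ?d2 = "deriv (deriv f) (fst (X w))"
  have "g w (nabla u (nabla v (e r)) w - nabla v (nabla u (e r)) w) (n w) =
    - (?d2 + ?d1\<^sup>2) * (fst (e u w) * (E * B (e v w) (e r w)) - fst (e v w) * (E * B (e u w) (e r w))) * fst (n w)
    + (\<kappa> - ?d1\<^sup>2 * E) * (E * (B (e v w) (e r w) * B (e u w) (n w) - B (e u w) (e r w) * B (e v w) (n w)))
    + (?d2 + ?d1\<^sup>2) * fst (e r w) * (fst (e u w) * (E * B (e v w) (n w)) - fst (e v w) * (E * B (e u w) (n w)))"
    unfolding curvature_normal_component[OF w smooth_e e_tangent[OF w]] E_def by (simp add: algebra_simps)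
  also have "(\<kappa> - ?d1\<^sup>2 * E) * (E * (B (e v w) (e r w) * B (e u w) (n w) - B (e u w) (e r w) * B (e v w) (n w)))
      = (\<kappa> * K - ?d1\<^sup>2 * (E * K)) * (- fst (n w) * \<rho> w * (fst (e u w) * (v \<bullet> r) - fst (e v w) * (u \<bullet> r)))"
    unfolding 3 by (simp add: algebra_simps)
  finally show ?thesis
    unfolding 1 2 EK K_def[symmetric] by (simp add: algebra_simps)
qed

text \<open>The second fundamental form on coordinate vectors, taken as the normal part of the
  derivative of the frame: it is symmetric by torsion-freeness, can be differentiated directly and
  avoids the definite description in \<open>shape_operator\<close>.\<close>

definition b :: "complex \<Rightarrow> complex \<Rightarrow> complex \<Rightarrow> real" where
  "b u v w = g w (nabla u (e v) w) (n w)"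

lemma b_commute: "w \<in> \<Omega> \<Longrightarrow> b u v w = b v u w"
  by (simp add: b_def nabla_e_commute[of w u v])

lemma nabla_e_tangent: "w \<in> \<Omega> \<Longrightarrow> nabla u (e v) w \<in> T w"
  by (rule nabla_in_T[OF _ e_differentiable e_tangent])

lemma nabla_n_tangent: "w \<in> \<Omega> \<Longrightarrow> nabla u n w \<in> T w"
  by (rule nabla_in_T[OF _ n_differentiable n_tangent])

lemma constant_on_imp_derivative_0:
  fixes F :: "complex \<Rightarrow> real"
  assumes "w \<in> \<Omega>" and D: "(F has_derivative F') (at w)" and "\<And>x. x \<in> \<Omega> \<Longrightarrow> F x = c"
  shows "F' u = 0"
proof -
  have "(F has_derivative (\<lambda>_. 0)) (at w)"
    by (rule has_derivative_transform_within_open[OF has_derivative_const[of c] open_dom assms(1)]) (simp add: assms(3))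
  from has_derivative_unique[OF D this] show ?thesis by simp
qed

lemma g_nabla_n_e:
  assumes w: "w \<in> \<Omega>"
  shows "g w (nabla u n w) (e v w) = - b u v w"
  using constant_on_imp_derivative_0[OF w metric_compat[OF w n_differentiable[OF w] e_differentiable[OF w]
        n_tangent[OF w] e_tangent[OF w]] normal_e[of _ v], of u]
  by (simp add: b_def warped_metric_commute[of _ _ _ "n w"])

lemma g_nabla_n_n:
  assumes w: "w \<in> \<Omega>"
  shows "g w (nabla u n w) (n w) = 0"
  using constant_on_imp_derivative_0[OF w metric_compat[OF w n_differentiable[OF w] n_differentiable[OF w]
        n_tangent[OF w] n_tangent[OF w]] n_unit, of u]
    warped_metric_commute[of \<kappa> f "X w" "nabla u n w" "n w"]
  by simp

lemma b_has_derivative: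
  assumes w: "w \<in> \<Omega>"
  shows "(b v r has_derivative (\<lambda>u. g w (nabla u (nabla v (e r)) w) (n w) + g w (nabla v (e r) w) (nabla u n w))) (at w)"
  unfolding b_def[abs_def]
  by (rule metric_compat[OF w nabla_differentiable[OF w smooth_e] n_differentiable[OF w]
        nabla_e_tangent[OF w] n_tangent[OF w]])

lemma g_nabla_n:
  assumes w: "w \<in> \<Omega>" and Z: "Z \<in> T w"
  shows "g w Z (nabla u n w) = - ((b u 1 w * g w Z (e 1 w) + b u \<i> w * g w Z (e \<i> w)) / \<rho> w)"
  using parseval[OF w nabla_n_tangent[OF w], of u Z]
  by (simp add: g_nabla_n_e[OF w] g_nabla_n_n[OF w] warped_metric_commute[of _ _ _ "nabla u n w" Z] diff_divide_distrib add_divide_distrib)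

text \<open>Differentiating \<open>b\<close> and antisymmetrising yields the curvature term plus
  pairings of the derivatives of the frame with those of the normal. The latter are left as
  Christoffel symbols of the surface, evaluated by \<open>g_nabla_e_e\<close>.\<close>

lemma codazzi:
  assumes w: "w \<in> \<Omega>"
  shows "dird u (b v r) w - dird v (b u r) w =
    - (deriv (deriv f) (fst (X w)) + \<kappa> * exp (- 2 * f (fst (X w)))) * fst (n w) * \<rho> w *
      (fst (e u w) * (v \<bullet> r) - fst (e v w) * (u \<bullet> r))
    - (b u 1 w * g w (nabla v (e r) w) (e 1 w) + b u \<i> w * g w (nabla v (e r) w) (e \<i> w)) / \<rho> w
    + (b v 1 w * g w (nabla u (e r) w) (e 1 w) + b v \<i> w * g w (nabla u (e r) w) (e \<i> w)) / \<rho> w"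
  using curvature_e[OF w, of u v r, unfolded warped_metric_algebra]
  unfolding dird_eq[OF b_has_derivative[OF w]] g_nabla_n[OF w nabla_e_tangent[OF w]]
  by linarith

text \<open>The conformal factor is the squared length of \<open>e 1\<close>, so it inherits
  differentiability from the immersion.\<close>

lemma rho_has_derivative:
  assumes w: "w \<in> \<Omega>"
  shows "(\<rho> has_derivative (\<lambda>u. dird u \<rho> w)) (at w)"
proof -
  have "(\<rho> has_derivative (\<lambda>u. g w (nabla u (e 1) w) (e 1 w) + g w (e 1 w) (nabla u (e 1) w))) (at w)"
    by (rule has_derivative_transform_within_open[OF metric_compat[OF w e_differentiable[OF w] e_differentiable[OF w]
        e_tangent[OF w] e_tangent[OF w]] open_dom w]) (simp add: conformal)
  then have "\<rho> differentiable (at w)" by (rule differentiableI)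
  then show ?thesis by (rule has_derivative_dird)
qed

text \<open>Koszul formula for the conformal metric: three cyclic instances of compatibility
  combined with torsion-freeness.\<close>

lemma g_nabla_e_e:
  assumes w: "w \<in> \<Omega>"
  shows "g w (nabla u (e v) w) (e r w) =
    (dird u \<rho> w * (v \<bullet> r) + dird v \<rho> w * (u \<bullet> r) - dird r \<rho> w * (u \<bullet> v)) / 2"
proof -
  have 1: "dird u \<rho> w * (v \<bullet> r) = g w (nabla u (e v) w) (e r w) + g w (nabla u (e r) w) (e v w)" for u v r
  proof -
    have "((\<lambda>w. g w (e v w) (e r w)) has_derivative (\<lambda>u. dird u \<rho> w * (v \<bullet> r))) (at w)"
      by (rule has_derivative_transform_within_open[OF has_derivative_mult_left[OF rho_has_derivative[OF w]] open_dom w])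
         (simp add: conformal)
    from fun_cong[OF has_derivative_unique[OF this metric_compat[OF w e_differentiable[OF w] e_differentiable[OF w]
        e_tangent[OF w] e_tangent[OF w]]], of u] show ?thesis
      using warped_metric_commute[of \<kappa> f "X w" "e v w" "nabla u (e r) w"] by simp
  qed
  from 1[of u v r] 1[of v u r] 1[of r u v] show ?thesis
    unfolding nabla_e_commute[OF w, of v u] nabla_e_commute[OF w, of r u] nabla_e_commute[OF w, of r v]
    by (simp add: inner_commute[of v u])
qed

lemma normal_height_derivative:
  assumes w: "w \<in> \<Omega>"
  shows "((\<lambda>w. fst (n w)) has_derivative (\<lambda>u. - deriv f (fst (X w)) * fst (e u w) * fst (n w)
    - (b u 1 w * fst (e 1 w) + b u \<i> w * fst (e \<i> w)) / \<rho> w)) (at w)"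
proof -
  have "fst (nabla u n w) = - ((b u 1 w * fst (e 1 w) + b u \<i> w * fst (e \<i> w)) / \<rho> w)" for u
    using g_nabla_n[OF w vertical_tangent, of u] by (simp add: g_vertical)
  then show ?thesis
    using metric_compat[OF w differentiable_const n_differentiable[OF w] vertical_tangent n_tangent[OF w]]
    by (simp add: g_vertical nabla_vertical warped_metric_algebra e_normal[OF w] algebra_simps)
qed

lemma e_height_derivative:
  assumes w: "w \<in> \<Omega>"
  shows "((\<lambda>w. fst (e v w)) has_derivative (\<lambda>u. deriv f (fst (X w)) * (\<rho> w * (u \<bullet> v) - fst (e u w) * fst (e v w))
    + (fst (e 1 w) * g w (nabla u (e v) w) (e 1 w) + fst (e \<i> w) * g w (nabla u (e v) w) (e \<i> w)) / \<rho> w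
    + fst (n w) * b u v w)) (at w)"
  using metric_compat[OF w differentiable_const e_differentiable[OF w] vertical_tangent e_tangent[OF w], of v]
    parseval[OF w vertical_tangent, of "nabla _ (e v) w"]
  by (simp add: g_vertical nabla_vertical warped_metric_algebra conformal[OF w] b_def algebra_simps)

text \<open>Parseval for the unit vertical field: the squared lengths of its tangent and normal
  parts add up to 1.\<close>

lemma vertical_unit:
  assumes w: "w \<in> \<Omega>"
  shows "(fst (e 1 w))\<^sup>2 + (fst (e \<i> w))\<^sup>2 = \<rho> w * (1 - (fst (n w))\<^sup>2)"
proof -
  have "1 = ((fst (e 1 w))\<^sup>2 + (fst (e \<i> w))\<^sup>2) / \<rho> w + (fst (n w))\<^sup>2"
    using parseval[OF w vertical_tangent, of vertical_field] unfolding g_vertical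
    by (simp add: vertical_field_def power2_eq_square)
  then show ?thesis using rho_pos[OF w] by (simp add: field_simps)
qed

text \<open>Supplies the witness for the definite description in
  \<open>shape_operator\<close>.\<close>

lemma weingarten:
  assumes w: "w \<in> \<Omega>"
  shows "nabla u n w = - e (Complex (b u 1 w / \<rho> w) (b u \<i> w / \<rho> w)) w"
proof -
  have "Complex x y = x *\<^sub>R 1 + y *\<^sub>R \<i>" for x y by (simp add: complex_eq_iff)
  then have "e (Complex x y) w = x *\<^sub>R e 1 w + y *\<^sub>R e \<i> w" for x y
    by (simp only: linear_add[OF linear_e[OF w]] linear_scale[OF linear_e[OF w]])
  then show ?thesis
    using frame_expansion[OF w nabla_n_tangent[OF w], of u]
    by (simp add: g_nabla_n_e[OF w] g_nabla_n_n[OF w])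
qed

end

section \<open>The equations in a conformal parameter\<close>

lemma has_derivative_Complex:
  assumes "(A has_derivative A') F" "(C has_derivative C') F"
  shows "((\<lambda>w. Complex (A w) (C w)) has_derivative (\<lambda>u. Complex (A' u) (C' u))) F"
  unfolding Complex_eq using assms by (auto intro!: derivative_eq_intros)

lemma d_z_eq: "(F has_derivative F') (at z) \<Longrightarrow> d_z F z = (F' 1 - \<i> * F' \<i>) / 2"
  unfolding d_z_def by (metis frechet_derivative_at)

lemma d_zbar_eq: "(F has_derivative F') (at z) \<Longrightarrow> d_zbar F z = (F' 1 + \<i> * F' \<i>) / 2"
  unfolding d_zbar_def by (metis frechet_derivative_at)

lemma d_Complex:
  assumes "(A has_derivative A') (at z)" "(C has_derivative C') (at z)"
  shows "d_z (\<lambda>w. Complex (A w) (C w)) z = Complex ((A' 1 + C' \<i>) / 2) ((C' 1 - A' \<i>) / 2)"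
    and "d_zbar (\<lambda>w. Complex (A w) (C w)) z = Complex ((A' 1 - C' \<i>) / 2) ((C' 1 + A' \<i>) / 2)"
  using d_z_eq[OF has_derivative_Complex[OF assms]] d_zbar_eq[OF has_derivative_Complex[OF assms]]
  by (simp_all add: complex_eq_iff)

lemma d_of_real:
  assumes "(A has_derivative A') (at z)"
  shows "d_z (\<lambda>w. complex_of_real (A w)) z = Complex (A' 1 / 2) (- A' \<i> / 2)"
    and "d_zbar (\<lambda>w. complex_of_real (A w)) z = Complex (A' 1 / 2) (A' \<i> / 2)"
  using d_Complex[OF assms has_derivative_const[of 0]] by (simp_all add: complex_of_real_def)

lemma d_z_cong:
  assumes "open U" "z \<in> U" "\<And>w. w \<in> U \<Longrightarrow> F w = H w"
  shows "d_z F z = d_z H z"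
  using dird_cong[OF assms] by (simp add: d_z_def dird_def)

lemma d_zbar_cong:
  assumes "open U" "z \<in> U" "\<And>w. w \<in> U \<Longrightarrow> F w = H w"
  shows "d_zbar F z = d_zbar H z"
  using dird_cong[OF assms] by (simp add: d_zbar_def dird_def)

lemma d_zbar_add:
  assumes "F differentiable (at z)" "H differentiable (at z)"
  shows "d_zbar (\<lambda>w. F w + H w) z = d_zbar F z + d_zbar H z"
  unfolding d_zbar_eq[OF has_derivative_add[OF assms[THEN has_derivative_dird]]]
  by (simp add: d_zbar_def dird_def field_simps)

lemma d_zbar_minus:
  assumes "F differentiable (at z)"
  shows "d_zbar (\<lambda>w. - F w) z = - d_zbar F z"
  unfolding d_zbar_eq[OF has_derivative_minus[OF assms[THEN has_derivative_dird]]]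
  by (simp add: d_zbar_def dird_def field_simps)

lemma d_zbar_mult:
  assumes "F differentiable (at z)" "H differentiable (at z)"
  shows "d_zbar (\<lambda>w. F w * H w) z = F z * d_zbar H z + d_zbar F z * H z"
  unfolding d_zbar_eq[OF has_derivative_mult[OF assms[THEN has_derivative_dird]]]
  by (simp add: d_zbar_def dird_def field_simps)

context conformal_immersion begin

text \<open>Value of the second fundamental form on \<open>partial_z\<close> twice, split into real
  and imaginary part so that derivatives reduce to those of \<open>b\<close>;
  \<open>hopf_coeff_eq\<close> makes the identification.\<close>

definition hopf :: "complex \<Rightarrow> complex" where
  "hopf w = Complex ((b 1 1 w - b \<i> \<i> w) / 4) (- b 1 \<i> w / 2)"

definition mean :: "complex \<Rightarrow> real" where
  "mean w = (b 1 1 w + b \<i> \<i> w) / (2 * \<rho> w)"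

definition h_z :: "complex \<Rightarrow> complex" where
  "h_z w = Complex (fst (e 1 w) / 2) (- fst (e \<i> w) / 2)"

abbreviation "f1 w \<equiv> deriv f (fst (X w))"
abbreviation "f2 w \<equiv> deriv (deriv f) (fst (X w))"
abbreviation "\<nu> w \<equiv> fst (n w)"

lemma d_height:
  assumes w: "w \<in> \<Omega>"
  shows "d_z (\<lambda>w. complex_of_real (fst (X w))) w = h_z w"
    and "d_zbar (\<lambda>w. complex_of_real (fst (X w))) w = cnj (h_z w)"
  by (simp_all add: d_of_real[OF height_has_derivative[OF w]] h_z_def complex_eq_iff)

lemma b_dird: "w \<in> \<Omega> \<Longrightarrow> (b u v has_derivative (\<lambda>r. dird r (b u v) w)) (at w)"
  using has_derivative_dird[OF differentiableI[OF b_has_derivative]] .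

lemma mean_has_derivative:
  assumes w: "w \<in> \<Omega>"
  shows "(mean has_derivative (\<lambda>u. (dird u (b 1 1) w + dird u (b \<i> \<i>) w) / (2 * \<rho> w)
    - (b 1 1 w + b \<i> \<i> w) * dird u \<rho> w / (2 * (\<rho> w)\<^sup>2))) (at w)"
proof -
  have rho: "\<rho> w \<noteq> 0" using rho_pos[OF w] by simp
  then have "2 * \<rho> w \<noteq> 0" by simp
  from has_derivative_divide[OF has_derivative_add[OF b_dird[OF w] b_dird[OF w]]
      has_derivative_mult_right[OF rho_has_derivative[OF w], of 2] this]
  show ?thesis
    unfolding mean_def[abs_def]
    by (rule has_derivative_eq_rhs) (use rho in \<open>simp add: fun_eq_iff field_simps power2_eq_square\<close>)
qed

lemma d_zbar_h_z:
  assumes w: "w \<in> \<Omega>"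
  shows "d_zbar h_z w = complex_of_real (\<nu> w * (\<rho> w * mean w / 2) + f1 w * (\<rho> w / 2 - (cmod (h_z w))\<^sup>2))"
proof -
  have h_z: "h_z = (\<lambda>w. Complex (fst (e 1 w) * (1 / 2)) (fst (e \<i> w) * (- 1 / 2)))"
    by (simp add: fun_eq_iff h_z_def)
  \<comment> \<open>The second derivative of the height in the directions \<open>u\<close> and
    \<open>v\<close>.\<close>
  define H where "H u v = f1 w * (\<rho> w * (u \<bullet> v) - fst (e u w) * fst (e v w))
    + (fst (e 1 w) * g w (nabla u (e v) w) (e 1 w) + fst (e \<i> w) * g w (nabla u (e v) w) (e \<i> w)) / \<rho> w
    + fst (n w) * b u v w" for u v
  have "d_zbar h_z w = Complex ((H 1 1 + H \<i> \<i>) / 4) ((H \<i> 1 - H 1 \<i>) / 4)"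
    unfolding h_z d_Complex(2)[OF has_derivative_mult_left[OF e_height_derivative[OF w]]
        has_derivative_mult_left[OF e_height_derivative[OF w]]] H_def[symmetric]
    by (simp add: complex_eq_iff field_simps)
  \<comment> \<open>In the trace the Christoffel symbols of the conformal metric cancel; the
    imaginary part vanishes by symmetry of second derivatives.\<close>
  moreover have "H 1 1 + H \<i> \<i> = \<nu> w * (b 1 1 w + b \<i> \<i> w) + f1 w * (2 * \<rho> w - (fst (e 1 w))\<^sup>2 - (fst (e \<i> w))\<^sup>2)"
    by (simp add: H_def g_nabla_e_e[OF w] algebra_simps power2_eq_square add_divide_distrib diff_divide_distrib)
  moreover have "H \<i> 1 = H 1 \<i>"
    by (simp add: H_def nabla_e_commute[OF w, of \<i> 1] b_commute[OF w, of \<i> 1])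
  moreover have "\<rho> w * mean w = (b 1 1 w + b \<i> \<i> w) / 2"
    using rho_pos[OF w] by (simp add: mean_def)
  moreover have "(cmod (h_z w))\<^sup>2 = ((fst (e 1 w))\<^sup>2 + (fst (e \<i> w))\<^sup>2) / 4"
    by (simp add: h_z_def cmod_power2 power_divide)
  ultimately show ?thesis
    by (simp add: complex_eq_iff algebra_simps add_divide_distrib diff_divide_distrib)
qed

text \<open>The auxiliary equation needed to differentiate the Hopf term of the angle equation. Kept
  multiplied by \<rho>, it exhibits the derivative of \<rho> that later cancels.\<close>

lemma d_zbar_cnj_h_z:
  assumes w: "w \<in> \<Omega>"
  shows "\<rho> w * d_zbar (\<lambda>w. cnj (h_z w)) w =
    d_zbar (\<lambda>w. complex_of_real (\<rho> w)) w * cnj (h_z w) + \<rho> w * cnj (hopf w) * \<nu> w - \<rho> w * f1 w * (cnj (h_z w))\<^sup>2"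
proof -
  have cnj_h_z: "(\<lambda>w. cnj (h_z w)) = (\<lambda>w. Complex (fst (e 1 w) * (1 / 2)) (fst (e \<i> w) * (1 / 2)))"
    by (simp add: fun_eq_iff h_z_def complex_eq_iff)
  show ?thesis
    unfolding d_of_real(2)[OF rho_has_derivative[OF w]] cnj_h_z
      d_Complex(2)[OF has_derivative_mult_left[OF e_height_derivative[OF w]]
        has_derivative_mult_left[OF e_height_derivative[OF w]]]
    using rho_pos[OF w]
    by (simp add: g_nabla_e_e[OF w] b_commute[OF w, of \<i> 1] complex_eq_iff hopf_def h_z_def power2_eq_square)
      (simp add: field_simps power2_eq_square)
qed

lemma d_zbar_hopf:
  assumes w: "w \<in> \<Omega>"
  shows "d_zbar hopf w = \<rho> w / 2 * d_z (\<lambda>w. complex_of_real (mean w)) w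
    + \<rho> w / 2 * (f2 w + \<kappa> * exp (- 2 * f (fst (X w)))) * \<nu> w * h_z w"
proof -
  define K where "K = f2 w + \<kappa> * exp (- 2 * f (fst (X w)))"
  have rho: "\<rho> w \<noteq> 0" using rho_pos[OF w] by simp
  have hopf': "hopf = (\<lambda>w. Complex ((b 1 1 w - b \<i> \<i> w) * (1 / 4)) (b 1 \<i> w * (- 1 / 2)))"
    by (simp add: fun_eq_iff hopf_def)
  have sym: "dird u (b \<i> 1) w = dird u (b 1 \<i>) w" for u
    by (rule dird_cong[OF open_dom w]) (rule b_commute)
  \<comment> \<open>Antisymmetry leaves two independent instances of Codazzi. In each, the
    Christoffel symbols combine into the mean curvature times a derivative of \<rho>.\<close>
  have 1: "dird \<i> (b 1 1) w - dird 1 (b 1 \<i>) w = - K * \<nu> w * \<rho> w * fst (e \<i> w) + mean w * dird \<i> \<rho> w"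
    using codazzi[OF w, of \<i> 1 1] rho unfolding K_def[symmetric]
    by (simp add: sym g_nabla_e_e[OF w] b_commute[OF w, of \<i> 1] mean_def)
      (simp add: field_simps)
  have 2: "dird 1 (b \<i> \<i>) w - dird \<i> (b 1 \<i>) w = - K * \<nu> w * \<rho> w * fst (e 1 w) + mean w * dird 1 \<rho> w"
    using codazzi[OF w, of 1 \<i> \<i>] rho unfolding K_def[symmetric]
    by (simp add: sym g_nabla_e_e[OF w] b_commute[OF w, of \<i> 1] mean_def)
      (simp add: field_simps)
  \<comment> \<open>The quotient rule for the mean curvature yields the same product of mean
    curvature and derivative of \<rho>, which thus disappears from the final identity.\<close>
  have H: "\<rho> w * ((dird u (b 1 1) w + dird u (b \<i> \<i>) w) / (2 * \<rho> w)
    - (b 1 1 w + b \<i> \<i> w) * dird u \<rho> w / (2 * (\<rho> w)\<^sup>2)) =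
      (dird u (b 1 1) w + dird u (b \<i> \<i>) w) / 2 - mean w * dird u \<rho> w" for u
    using rho by (simp add: mean_def field_simps power2_eq_square)
  have "Re (d_zbar hopf w) = (dird 1 (b 1 1) w - dird 1 (b \<i> \<i>) w + 2 * dird \<i> (b 1 \<i>) w) / 8"
    "Im (d_zbar hopf w) = (dird \<i> (b 1 1) w - dird \<i> (b \<i> \<i>) w - 2 * dird 1 (b 1 \<i>) w) / 8"
    unfolding hopf' d_Complex(2)[OF has_derivative_mult_left[OF has_derivative_diff[OF b_dird[OF w] b_dird[OF w]]]
        has_derivative_mult_left[OF b_dird[OF w]]]
    by (simp_all add: field_simps)
  moreover have "Re (\<rho> w / 2 * d_z (\<lambda>w. complex_of_real (mean w)) w + \<rho> w / 2 * K * \<nu> w * h_z w) =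
     ((dird 1 (b 1 1) w + dird 1 (b \<i> \<i>) w) / 2 - mean w * dird 1 \<rho> w) / 4 + K * \<nu> w * \<rho> w * fst (e 1 w) / 4"
    "Im (\<rho> w / 2 * d_z (\<lambda>w. complex_of_real (mean w)) w + \<rho> w / 2 * K * \<nu> w * h_z w) =
     - ((dird \<i> (b 1 1) w + dird \<i> (b \<i> \<i>) w) / 2 - mean w * dird \<i> \<rho> w) / 4 - K * \<nu> w * \<rho> w * fst (e \<i> w) / 4"
    unfolding H[symmetric] d_of_real(1)[OF mean_has_derivative[OF w]] h_z_def
    by (simp_all add: algebra_simps)
  moreover have "complex_of_real K = f2 w + \<kappa> * exp (- 2 * f (fst (X w)))"
    by (simp add: K_def)
  ultimately show ?thesis
    unfolding complex_eq_iff of_real_add[symmetric] of_real_mult[symmetric] K_def[symmetric] using 1 2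
    by (simp add: field_simps)
qed

lemma d_z_angle:
  assumes w: "w \<in> \<Omega>"
  shows "d_z (\<lambda>w. complex_of_real (\<nu> w)) w =
    - mean w * h_z w - 2 * hopf w / \<rho> w * cnj (h_z w) - f1 w * \<nu> w * h_z w"
  unfolding d_of_real(1)[OF normal_height_derivative[OF w]]
  using rho_pos[OF w]
  by (simp add: complex_eq_iff mean_def hopf_def h_z_def b_commute[OF w, of \<i> 1])
    (simp add: field_simps)

text \<open>Source of the factor \<open>1 - \<nu>\<^sup>2\<close> in the last equation.\<close>

lemma cmod_h_z:
  assumes w: "w \<in> \<Omega>"
  shows "(cmod (h_z w))\<^sup>2 = \<rho> w * (1 - (\<nu> w)\<^sup>2) / 4"
  using vertical_unit[OF w] by (simp add: h_z_def cmod_power2 power_divide)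

lemma differentiable_at_dom:
  assumes w: "w \<in> \<Omega>"
  shows "(\<lambda>w. complex_of_real (\<rho> w)) differentiable (at w)"
    and "(\<lambda>w. complex_of_real (\<nu> w)) differentiable (at w)"
    and "(\<lambda>w. complex_of_real (mean w)) differentiable (at w)"
    and "(\<lambda>w. complex_of_real (f1 w)) differentiable (at w)"
    and "h_z differentiable (at w)"
    and "(\<lambda>w. cnj (h_z w)) differentiable (at w)"
    and "hopf differentiable (at w)"
proof -
  show "(\<lambda>w. complex_of_real (\<rho> w)) differentiable (at w)"
    using has_derivative_of_real[OF rho_has_derivative[OF w]] by (rule differentiableI)
  show "(\<lambda>w. complex_of_real (\<nu> w)) differentiable (at w)"
    using has_derivative_of_real[OF normal_height_derivative[OF w]] by (rule differentiableI)
  show "(\<lambda>w. complex_of_real (mean w)) differentiable (at w)"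
    using has_derivative_of_real[OF mean_has_derivative[OF w]] by (rule differentiableI)
  show "(\<lambda>w. complex_of_real (f1 w)) differentiable (at w)"
    using has_derivative_of_real[OF f_has_derivative(2)[OF w]] by (rule differentiableI)
  have e: "(\<lambda>w. fst (e u w) * c) differentiable (at w)" for u c
    using has_derivative_mult_left[OF e_height_derivative[OF w]] by (rule differentiableI)
  have C: "(\<lambda>w. Complex (A w) (C w)) differentiable (at w)"
    if "A differentiable (at w)" "C differentiable (at w)" for A C
    using has_derivative_Complex[OF that[THEN has_derivative_dird]] by (rule differentiableI)
  have "h_z = (\<lambda>w. Complex (fst (e 1 w) * (1 / 2)) (fst (e \<i> w) * (- 1 / 2)))"
    by (simp add: fun_eq_iff h_z_def)
  then show "h_z differentiable (at w)" using C[OF e e] by metis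
  have "(\<lambda>w. cnj (h_z w)) = (\<lambda>w. Complex (fst (e 1 w) * (1 / 2)) (fst (e \<i> w) * (1 / 2)))"
    by (simp add: fun_eq_iff h_z_def complex_eq_iff)
  then show "(\<lambda>w. cnj (h_z w)) differentiable (at w)" using C[OF e e] by metis
  have "hopf = (\<lambda>w. Complex ((b 1 1 w - b \<i> \<i> w) * (1 / 4)) (b 1 \<i> w * (- 1 / 2)))"
    by (simp add: fun_eq_iff hopf_def)
  then show "hopf differentiable (at w)"
    using C[OF differentiableI[OF has_derivative_mult_left[OF has_derivative_diff[OF b_dird[OF w] b_dird[OF w]]]]
        differentiableI[OF has_derivative_mult_left[OF b_dird[OF w]]]] by metis
qed

lemma d_zbar_d_z_angle:
  assumes w: "w \<in> \<Omega>"
  shows "d_zbar (d_z (\<lambda>w. complex_of_real (\<nu> w))) w =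
    - (d_zbar (\<lambda>w. complex_of_real (mean w)) w * h_z w + d_z (\<lambda>w. complex_of_real (mean w)) w * cnj (h_z w))
    - \<rho> w * \<nu> w / 4 * ((f2 w + \<kappa> * exp (- 2 * f (fst (X w)))) * (1 - (\<nu> w)\<^sup>2)
        + 8 * (cmod (hopf w))\<^sup>2 / (\<rho> w)\<^sup>2 + 2 * (mean w)\<^sup>2)
    + f1 w * (2 * hopf w / \<rho> w * (cnj (h_z w))\<^sup>2 - mean w * (\<rho> w / 2 - (cmod (h_z w))\<^sup>2)
        - (d_zbar (\<lambda>w. complex_of_real (\<nu> w)) w * h_z w + \<nu> w * d_zbar h_z w))
    - f2 w * \<nu> w * (cmod (h_z w))\<^sup>2"
proof -
  define q where "q w = 2 * hopf w / \<rho> w" for w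
  define K where "K = f2 w + \<kappa> * exp (- 2 * f (fst (X w)))"
  note d = differentiable_at_dom[OF w]
  have rho: "complex_of_real (\<rho> w) \<noteq> 0" using rho_pos[OF w] by simp
  have dq: "q differentiable (at w)"
    unfolding q_def[abs_def] by (intro differentiable_divide differentiable_mult differentiable_const d rho)
  \<comment> \<open>Differentiating the identity \<open>\<rho> * q = 2 * hopf\<close> replaces the
    quotient rule.\<close>
  have q_rho: "\<rho> w * d_zbar q w + d_zbar (\<lambda>w. complex_of_real (\<rho> w)) w * q w = 2 * d_zbar hopf w"
  proof -
    have "d_zbar (\<lambda>w. \<rho> w * q w) w = d_zbar (\<lambda>w. 2 * hopf w) w"
      by (rule d_zbar_cong[OF open_dom w]) (use rho_pos in \<open>force simp: q_def\<close>)
    moreover have "d_zbar (\<lambda>w. 2 :: complex) w = 0" by (simp add: d_zbar_eq[OF has_derivative_const])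
    ultimately show ?thesis by (simp add: d_zbar_mult d dq)
  qed
  have f1': "d_zbar (\<lambda>w. complex_of_real (f1 w)) w = f2 w * cnj (h_z w)"
    by (simp add: d_of_real[OF f_has_derivative(2)[OF w]] h_z_def complex_eq_iff)
  have "d_zbar (d_z (\<lambda>w. complex_of_real (\<nu> w))) w =
    d_zbar (\<lambda>w. - (mean w * h_z w + q w * cnj (h_z w) + f1 w * (\<nu> w * h_z w))) w"
    by (rule d_zbar_cong[OF open_dom w]) (simp add: d_z_angle q_def)
  also have "\<dots> = - (mean w * d_zbar h_z w + d_zbar (\<lambda>w. complex_of_real (mean w)) w * h_z w
      + (q w * d_zbar (\<lambda>w. cnj (h_z w)) w + d_zbar q w * cnj (h_z w))
      + (f1 w * (\<nu> w * d_zbar h_z w + d_zbar (\<lambda>w. complex_of_real (\<nu> w)) w * h_z w)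
        + f2 w * cnj (h_z w) * (\<nu> w * h_z w)))"
    by (simp only: d_zbar_minus d_zbar_add d_zbar_mult differentiable_add differentiable_mult d dq f1')
  \<comment> \<open>Here Codazzi meets the auxiliary height equation. After multiplication by \<rho>
    the two terms containing the derivative of \<rho> are opposite; the Codazzi term gives the
    \<kappa> contribution and the conjugate Hopf coefficient gives its squared modulus.\<close>
  also have "q w * d_zbar (\<lambda>w. cnj (h_z w)) w + d_zbar q w * cnj (h_z w) =
      d_z (\<lambda>w. complex_of_real (mean w)) w * cnj (h_z w) + K * \<nu> w * (h_z w * cnj (h_z w))
      + 2 * (hopf w * cnj (hopf w)) / \<rho> w * \<nu> w - f1 w * (2 * hopf w / \<rho> w * (cnj (h_z w))\<^sup>2)"
  proof -
    define \<rho>' where "\<rho>' = d_zbar (\<lambda>w. complex_of_real (\<rho> w)) w"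
    have a: "\<rho> w * d_zbar (\<lambda>w. cnj (h_z w)) w =
        \<rho>' * cnj (h_z w) + \<rho> w * cnj (hopf w) * \<nu> w - \<rho> w * f1 w * (cnj (h_z w))\<^sup>2"
      unfolding \<rho>'_def by (rule d_zbar_cnj_h_z[OF w])
    have b: "\<rho> w * d_zbar q w = \<rho> w * d_z (\<lambda>w. complex_of_real (mean w)) w + \<rho> w * K * \<nu> w * h_z w - \<rho>' * q w"
      using q_rho unfolding d_zbar_hopf[OF w] \<rho>'_def[symmetric] K_def by (simp add: algebra_simps eq_diff_eq)
    have c: "\<rho> w * q w = 2 * hopf w" using rho by (simp add: q_def)
    have "\<rho> w * (q w * d_zbar (\<lambda>w. cnj (h_z w)) w + d_zbar q w * cnj (h_z w)) =
      q w * (\<rho> w * d_zbar (\<lambda>w. cnj (h_z w)) w) + (\<rho> w * d_zbar q w) * cnj (h_z w)"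
      by (simp add: algebra_simps)
    also have "\<dots> = \<rho> w * (d_z (\<lambda>w. complex_of_real (mean w)) w * cnj (h_z w) + K * \<nu> w * (h_z w * cnj (h_z w)))
      + (\<rho> w * q w) * (cnj (hopf w) * \<nu> w - f1 w * (cnj (h_z w))\<^sup>2)"
      unfolding a b by (simp add: algebra_simps)
    also have "\<dots> = \<rho> w * (d_z (\<lambda>w. complex_of_real (mean w)) w * cnj (h_z w) + K * \<nu> w * (h_z w * cnj (h_z w))
      + 2 * (hopf w * cnj (hopf w)) / \<rho> w * \<nu> w - f1 w * (2 * hopf w / \<rho> w * (cnj (h_z w))\<^sup>2))"
      unfolding c using rho by (simp add: field_simps)
    finally show ?thesis using rho by simp
  qed
  also have "h_z w * cnj (h_z w) = \<rho> w * (1 - (\<nu> w)\<^sup>2) / 4"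
    unfolding complex_norm_square[symmetric] cmod_h_z[OF w] by simp
  also have "complex_of_real (mean w) * d_zbar h_z w =
      mean w * (\<nu> w * (\<rho> w * mean w / 2)) + f1 w * (mean w * (\<rho> w / 2 - (cmod (h_z w))\<^sup>2))"
    unfolding d_zbar_h_z[OF w] by (simp add: algebra_simps)
  also have "f2 w * cnj (h_z w) * (\<nu> w * h_z w) = f2 w * \<nu> w * (cmod (h_z w))\<^sup>2"
    using complex_norm_square[of "h_z w"] by (simp add: algebra_simps)
  also have "hopf w * cnj (hopf w) = (cmod (hopf w))\<^sup>2"
    by (rule complex_norm_square[symmetric])
  finally have 1: "d_zbar (d_z (\<lambda>w. complex_of_real (\<nu> w))) w = - (mean w * (\<nu> w * (\<rho> w * mean w / 2))
      + f1 w * (mean w * (\<rho> w / 2 - (cmod (h_z w))\<^sup>2)) + d_zbar (\<lambda>w. complex_of_real (mean w)) w * h_z w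
      + (d_z (\<lambda>w. complex_of_real (mean w)) w * cnj (h_z w) + K * \<nu> w * (\<rho> w * (1 - (\<nu> w)\<^sup>2) / 4)
      + 2 * (cmod (hopf w))\<^sup>2 / \<rho> w * \<nu> w - f1 w * (2 * hopf w / \<rho> w * (cnj (h_z w))\<^sup>2))
      + (f1 w * (\<nu> w * d_zbar h_z w + d_zbar (\<lambda>w. complex_of_real (\<nu> w)) w * h_z w)
        + f2 w * \<nu> w * (cmod (h_z w))\<^sup>2))"
    by simp
  \<comment> \<open>The remaining rearrangement is stated for arbitrary complex numbers, so that the
    derivatives occurring in it are opaque to the simplifier.\<close>
  have 2: "- (m * (\<nu> * (l * m / 2)) + a * (m * (l / 2 - c)) + mb * hz
      + (mz * hb + K * \<nu> * (l * (1 - \<nu>\<^sup>2) / 4) + 2 * pp / l * \<nu> - a * (2 * p / l * hb\<^sup>2))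
      + (a * (\<nu> * hh + nb * hz) + a' * \<nu> * c)) =
    - (mb * hz + mz * hb) - l * \<nu> / 4 * (K * (1 - \<nu>\<^sup>2) + 8 * pp / l\<^sup>2 + 2 * m\<^sup>2)
    + a * (2 * p / l * hb\<^sup>2 - m * (l / 2 - c) - (nb * hz + \<nu> * hh)) - a' * \<nu> * c"
    if "l \<noteq> 0" for m \<nu> l a c mb hz mz hb K pp p hh nb a' :: complex
    using that by (simp add: field_simps power2_eq_square)
  show ?thesis
    using 1[unfolded of_real_add of_real_mult of_real_diff of_real_divide of_real_numeral of_real_1 of_real_power of_real_minus]
    unfolding 2[OF rho]
    by (simp add: K_def)
qed

section \<open>Identification with the geometric definitions\<close>

lemma first_form_eq: "w \<in> \<Omega> \<Longrightarrow> first_form (warped_metric \<kappa> f) X w u v = \<rho> w * (u \<bullet> v)"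
  using conformal by (simp add: first_form_def dird_def)

text \<open>Only the values of \<open>G\<close> on tangent vectors at \<open>X w\<close> enter, as
  the frame and the normal are tangent to the ambient manifold. The witness is unique by injectivity
  of the differential of the immersion.\<close>

lemma shape_operator_eq:
  assumes w: "w \<in> \<Omega>"
    and G: "\<And>u v. u \<in> T w \<Longrightarrow> v \<in> T w \<Longrightarrow> G (X w) u v = warped_christoffel \<kappa> f (X w) u v"
  shows "shape_operator G X n w u = Complex (b u 1 w / \<rho> w) (b u \<i> w / \<rho> w)"
  unfolding shape_operator_def
proof (rule the_equality)
  have cov: "covariant_deriv_along G X n w u = nabla u n w"
    using G[OF e_tangent[OF w] n_tangent[OF w]]
    by (simp add: covariant_deriv_along_def nabla_def dird_def)
  show "covariant_deriv_along G X n w u = - frechet_derivative X (at w) (Complex (b u 1 w / \<rho> w) (b u \<i> w / \<rho> w))"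
    unfolding cov weingarten[OF w] by (simp add: dird_def)
  fix v assume "covariant_deriv_along G X n w u = - frechet_derivative X (at w) v"
  then have "e v w = e (Complex (b u 1 w / \<rho> w) (b u \<i> w / \<rho> w)) w"
    unfolding cov weingarten[OF w] by (simp add: dird_def)
  then show "v = Complex (b u 1 w / \<rho> w) (b u \<i> w / \<rho> w)"
    using immersed[OF w] by (simp add: inj_def)
qed

lemma second_form_eq:
  assumes w: "w \<in> \<Omega>"
    and G: "\<And>u v. u \<in> T w \<Longrightarrow> v \<in> T w \<Longrightarrow> G (X w) u v = warped_christoffel \<kappa> f (X w) u v"
  shows "second_form (warped_metric \<kappa> f) G X n w u v = b u 1 w * Re v + b u \<i> w * Im v"
  using rho_pos[OF w]
  by (simp add: second_form_def shape_operator_eq[where G = G, OF w G] first_form_eq[OF w] inner_complex_def distrib_left)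

lemma hopf_coeff_eq:
  assumes w: "w \<in> \<Omega>"
    and G: "\<And>u v. u \<in> T w \<Longrightarrow> v \<in> T w \<Longrightarrow> G (X w) u v = warped_christoffel \<kappa> f (X w) u v"
  shows "hopf_coeff (warped_metric \<kappa> f) G X n w = hopf w"
  by (simp add: hopf_coeff_def complex_bilinear_ext_def second_form_eq[where G = G, OF w G] partial_z_def hopf_def
      complex_eq_iff b_commute[OF w, of \<i> 1] field_simps)

lemma mean_curvature_eq:
  assumes w: "w \<in> \<Omega>"
    and G: "\<And>u v. u \<in> T w \<Longrightarrow> v \<in> T w \<Longrightarrow> G (X w) u v = warped_christoffel \<kappa> f (X w) u v"
  shows "mean_curvature G X n w = mean w"
  using rho_pos[OF w]
  by (simp add: mean_curvature_def shape_operator_eq[where G = G, OF w G] Basis_complex_def inner_complex_def mean_def field_simps)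

lemma gradient_height_norm:
  assumes w: "w \<in> \<Omega>"
  defines "v \<equiv> gradient (warped_metric \<kappa> f) X (\<lambda>w. fst (X w)) w"
  shows "first_form (warped_metric \<kappa> f) X w v v = 4 / \<rho> w * (cmod (h_z w))\<^sup>2"
proof -
  have rho: "\<rho> w \<noteq> 0" using rho_pos[OF w] by simp
  have d: "frechet_derivative (\<lambda>w. fst (X w)) (at w) u = fst (e 1 w) * Re u + fst (e \<i> w) * Im u" for u
  proof -
    have "u = Re u *\<^sub>R 1 + Im u *\<^sub>R \<i>" by (simp add: complex_eq_iff)
    then have "e u w = Re u *\<^sub>R e 1 w + Im u *\<^sub>R e \<i> w"
      using linear_add[OF linear_e[OF w]] linear_scale[OF linear_e[OF w]] by metis
    then show ?thesis
      using fun_cong[OF frechet_derivative_at[OF height_has_derivative[OF w]], of u] by (simp add: mult.commute)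
  qed
  \<comment> \<open>The gradient is the Euclidean one divided by the conformal factor; testing with
    \<open>1\<close> and \<open>\<i>\<close> gives uniqueness.\<close>
  have "v = Complex (fst (e 1 w) / \<rho> w) (fst (e \<i> w) / \<rho> w)"
    unfolding v_def gradient_def first_form_eq[OF w] d
  proof (rule the_equality)
    show "\<forall>u. \<rho> w * (Complex (fst (e 1 w) / \<rho> w) (fst (e \<i> w) / \<rho> w) \<bullet> u) = fst (e 1 w) * Re u + fst (e \<i> w) * Im u"
      using rho by (simp add: inner_complex_def field_simps)
    fix y assume *: "\<forall>u. \<rho> w * (y \<bullet> u) = fst (e 1 w) * Re u + fst (e \<i> w) * Im u"
    then show "y = Complex (fst (e 1 w) / \<rho> w) (fst (e \<i> w) / \<rho> w)"
      using rho *[rule_format, of 1] *[rule_format, of \<i>] by (simp add: complex_eq_iff inner_complex_def field_simps)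
  qed
  then show ?thesis
    using rho
    by (simp add: first_form_eq[OF w] inner_complex_def h_z_def cmod_power2)
      (simp add: power2_eq_square field_simps)
qed

end

theorem lemma3p3:
  fixes \<kappa> :: real
    and f :: "real \<Rightarrow> real"
    and G :: "ambient \<Rightarrow> ambient \<Rightarrow> ambient \<Rightarrow> ambient"
    and A :: "'a::{t2_space, second_countable_topology} chart set"
    and \<phi> N :: "'a \<Rightarrow> ambient"
    and c :: "'a chart"
    and \<rho> :: "complex \<Rightarrow> real"
    and z :: complex
  assumes "\<kappa> \<in> {-1, 0, 1}"
    and "smooth_on UNIV f"
    and "levi_civita (warped_space \<kappa>) (warped_tangent \<kappa>) (warped_metric \<kappa> f) G"
    and "smooth_surface A" and "orientable_surface A"
    and "immersion_into (warped_space \<kappa>) A \<phi>"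
    and "complete_induced (warped_metric \<kappa> f) A \<phi>"
    and "unit_normal (warped_tangent \<kappa>) (warped_metric \<kappa> f) A \<phi> N"
    and "c \<in> A"
    and "\<And>w u v. w \<in> snd c ` fst c \<Longrightarrow>
           first_form (warped_metric \<kappa> f) (local_rep c \<phi>) w u v = \<rho> w * (u \<bullet> v)"
    and "z \<in> snd c ` fst c"
  shows
    "let g = warped_metric \<kappa> f; X = local_rep c \<phi>; n = local_rep c N;
         H = (\<lambda>z. complex_of_real (mean_curvature G X n z));
         p = hopf_coeff g G X n;
         h = (\<lambda>z. fst (X z));
         \<nu> = (\<lambda>z. complex_of_real (g (X z) vertical_field (n z)));
         h\<^sub>z = d_z (\<lambda>z. complex_of_real (h z)); h\<^sub>z\<^sub>b = d_zbar (\<lambda>z. complex_of_real (h z));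
         l = complex_of_real (\<rho> z);
         f1 = complex_of_real (deriv f (h z));
         f2 = complex_of_real (deriv (deriv f) (h z));
         K = f2 + complex_of_real (\<kappa> * exp (- 2 * f (h z)))
     in
       d_zbar p z = l / 2 * d_z H z + l / 2 * K * \<nu> z * h\<^sub>z z \<and>
       first_form g X z (gradient g X h z) (gradient g X h z) = 4 / \<rho> z * (cmod (h\<^sub>z z))\<^sup>2 \<and>
       d_z \<nu> z = - H z * h\<^sub>z z - 2 * p z / l * h\<^sub>z\<^sub>b z - f1 * \<nu> z * h\<^sub>z z \<and>
       d_zbar h\<^sub>z z = \<nu> z * (l * H z / 2) + f1 * (l / 2 - (cmod (h\<^sub>z z))\<^sup>2) \<and>
       d_zbar (d_z \<nu>) z =
         - (d_zbar H z * h\<^sub>z z + d_z H z * h\<^sub>z\<^sub>b z)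
         - l * \<nu> z / 4 * (K * (1 - (\<nu> z)\<^sup>2) + 8 * (cmod (p z))\<^sup>2 / l\<^sup>2 + 2 * (H z)\<^sup>2)
         + f1 * (2 * p z / l * (h\<^sub>z\<^sub>b z)\<^sup>2 - H z * (l / 2 - (cmod (h\<^sub>z z))\<^sup>2)
                 - (d_zbar \<nu> z * h\<^sub>z z + \<nu> z * d_zbar h\<^sub>z z))
         - f2 * \<nu> z * (cmod (h\<^sub>z z))\<^sup>2"
proof -
  define X where "X = local_rep c \<phi>"
  define n where "n = local_rep c N"
  define \<Omega> where "\<Omega> = snd c ` fst c"
  have c: "is_chart c" using assms(4,9) by (simp add: smooth_surface_def)
  have pre: "inv_into (fst c) (snd c) w \<in> fst c" "snd c (inv_into (fst c) (snd c) w) = w" if "w \<in> \<Omega>" for w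
    using that unfolding \<Omega>_def by (auto intro: inv_into_into f_inv_into_f)
  have X: "X w = \<phi> (inv_into (fst c) (snd c) w)" and n: "n w = N (inv_into (fst c) (snd c) w)" for w
    by (simp_all add: X_def n_def local_rep_def)
  interpret conformal_immersion \<kappa> f \<Omega> X n \<rho>
  proof
    show "open \<Omega>" using c by (auto simp: is_chart_def \<Omega>_def)
    show "smooth_on \<Omega> X" using assms(6,9) by (simp add: immersion_into_def smooth_map_def \<Omega>_def X_def)
    show "smooth_on \<Omega> n" using assms(8,9) by (simp add: unit_normal_def smooth_map_def \<Omega>_def n_def)
    fix w assume w: "w \<in> \<Omega>"
    show "X w \<in> warped_space \<kappa>" using assms(6) by (auto simp: immersion_into_def X)
    show "n w \<in> warped_tangent \<kappa> (X w)" and "warped_metric \<kappa> f (X w) (n w) (n w) = 1"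
      using assms(8) by (simp_all add: unit_normal_def X n)
    have "\<forall>p\<in>fst c. \<forall>u. warped_metric \<kappa> f (\<phi> p) (frechet_derivative X (at (snd c p)) u) (N p) = 0"
      using assms(8,9) unfolding unit_normal_def X_def by blast
    from this[rule_format, OF pre(1)[OF w]]
    show "warped_metric \<kappa> f (X w) (dird u X w) (n w) = 0" for u
      by (simp add: pre(2)[OF w] dird_def X n)
    show "warped_metric \<kappa> f (X w) (dird u X w) (dird v X w) = \<rho> w * (u \<bullet> v)" for u v
      using assms(10)[of w u v] w by (simp add: first_form_def dird_def X_def \<Omega>_def)
    have "inj (frechet_derivative X (at w))"
      using assms(6,9) w unfolding immersion_into_def X_def \<Omega>_def by blast
    then show "inj (\<lambda>u. dird u X w)" by (simp add: dird_def)
  qed (use assms in auto)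
  have w: "z \<in> \<Omega>" using assms(11) by (simp add: \<Omega>_def)
  have G: "G (X w) u v = warped_christoffel \<kappa> f (X w) u v" if "w \<in> \<Omega>" "u \<in> T w" "v \<in> T w" for w u v
    using smooth_on_differentiable[OF assms(2)]
    by (intro levi_civita_warped_christoffel[OF kappa _ assms(3) X_in that(2,3)] that(1)) simp
  have hopf: "hopf_coeff (warped_metric \<kappa> f) G X n w = hopf w"
    and mean: "mean_curvature G X n w = mean w" if "w \<in> \<Omega>" for w
    using hopf_coeff_eq[where G = G, OF that G[OF that]] mean_curvature_eq[where G = G, OF that G[OF that]]
    by simp_all
  \<comment> \<open>The geometric quantities agree with the explicit ones on \<Omega> only, so
    derivatives are transferred through this open set.\<close>
  have 1: "d_zbar (hopf_coeff (warped_metric \<kappa> f) G X n) z = d_zbar hopf z"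
    by (rule d_zbar_cong[OF open_dom w hopf])
  have 2: "d_z (\<lambda>z. complex_of_real (mean_curvature G X n z)) z = d_z (\<lambda>w. complex_of_real (mean w)) z"
    by (rule d_z_cong[OF open_dom w]) (simp add: mean)
  have 3: "d_zbar (\<lambda>z. complex_of_real (mean_curvature G X n z)) z = d_zbar (\<lambda>w. complex_of_real (mean w)) z"
    by (rule d_zbar_cong[OF open_dom w]) (simp add: mean)
  have 4: "d_zbar (d_z (\<lambda>z. complex_of_real (fst (X z)))) z = d_zbar h_z z"
    by (rule d_zbar_cong[OF open_dom w]) (simp add: d_height)
  show ?thesis
    unfolding Let_def X_def[symmetric] n_def[symmetric] g_vertical 1 2 3 4 d_height[OF w] hopf[OF w] mean[OF w]
    using d_zbar_hopf[OF w] gradient_height_norm[OF w] d_z_angle[OF w] d_zbar_h_z[OF w] d_zbar_d_z_angle[OF w]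
    by (simp only: of_real_add of_real_mult of_real_diff of_real_divide of_real_numeral of_real_1 of_real_power
        of_real_minus)
qed

end
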